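(* Let $f:[0,\infty)\to[0,\infty)$ be continuous and nondecreasing with $f(u)\le A u^\alpha$ for all $u\ge0$, for some $A>0$ and $\alpha\in(1,\infty)$. Let $0\le u_0\in L^\gamma(\mathbb{R}^n)$ for some $\gamma\in[1,\infty)$, and assume $$\int_0^\infty\Big\|\int_{\mathbb{R}^n}\Gamma(0,y;t,\cdot)u_0(y)\,dy\Big\|_{L^\infty(\mathbb{R}^n)}^{\alpha-1}dt<\frac{1}{A(\alpha-1)}.$$ Then there exists a nonnegative (continuous) curve $u:[0,\infty)\to L^\gamma(\mathbb{R}^n)$ which is a global mild solution of $u_t-\mathcal{L}u=f(u)$, $u(0)=u_0$, i.e. $$u(t,x)=\int_{\mathbb{R}^n}\Gamma(0,y;t,x)u_0(y)\,dy+\int_0^t\int_{\mathbb{R}^n}\Gamma(0,y;t-\tau,x)f(u(\tau,y))\,dy\,d\tau,$$ and there is $C>1$ such that for a.e. $(t,x)\in(0,\infty)\times\mathbb{R}^n$ $$\int_{\mathbb{R}^n}\Gamma(0,y;t,x)u_0(y)\,dy\le u(t,x)\le C\int_{\mathbb{R}^n}\Gamma(0,y;t,x)u_0(y)\,dy.$$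
   Context: Standing setting. Let $X=\{X_1,\dots,X_m\}$ be smooth vector fields on $\mathbb{R}^n$, linearly independent as vector fields, satisfying: (H1) there are integers $1=\sigma_1\le\dots\le\sigma_n$ such that, with dilations $\delta_\lambda(x)=(\lambda^{\sigma_1}x_1,\dots,\lambda^{\sigma_n}x_n)$, $\lambda>0$, each $X_j$ is homogeneous of degree $1$, i.e. $X_j(\phi\circ\delta_\lambda)=\lambda\,(X_j\phi)\circ\delta_\lambda$ for all $\phi\in C^\infty(\mathbb{R}^n)$, $\lambda>0$; (H2) Hörmander's rank condition at $0$: the values at $0$ of the vector fields in the Lie algebra generated by $X_1,\dots,X_m$ span $\mathbb{R}^n$. Put $q:=\sigma_1+\dots+\sigma_n$, $\mathcal{L}:=\sum_{j=1}^mX_j^2$, $\mathcal{H}:=\partial_t-\mathcal{L}$. $\Gamma(t,x;s,y)$ denotes the global fundamental solution (heat kernel) of $\mathcal{H}$; for $t>0$, $x\mapsto\int\Gamma(0,y;t,x)\varphi(y)dy$ is the heat semigroup of $\mathcal{L}$ applied to $\varphi$. Known properties: $\Gamma\ge0$; $\Gamma(t,x;s,y)=0$ if $s\le t$; $\Gamma(0,y;t,x)=\Gamma(0,x;t,y)$; $\int_{\mathbb{R}^n}\Gamma(0,y;t,x)\,dy=1$ for $t>0$; $\Gamma(0,y;t+s,x)=\int\Gamma(0,w;t,x)\Gamma(0,y;s,w)\,dw$ for $t,s>0$; there is $\rho>1$ with $\frac{1}{\rho|B_X(x,\sqrt s)|}e^{-\rho d_X(x,y)^2/s}\le\Gamma(0,x;s,y)\le\frac{\rho}{|B_X(x,\sqrt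 s)|}e^{-d_X(x,y)^2/(\rho s)}$ for $s>0$, where $d_X$ is the Carnot–Carathéodory distance of $X$ and $B_X$ its balls; and $|B_X(x,r)|\ge c\,r^q$ for some $c>0$ and all $x,r$. *)

theory Defs
  imports "HOL-Analysis.Analysis" "HOL-Probability.Essential_Supremum"
begin

coinductive smooth_map :: "('a::real_normed_vector \<Rightarrow> 'b::real_normed_vector) \<Rightarrow> bool" where
  "f differentiable_on UNIV \<Longrightarrow> (\<forall>v. smooth_map (\<lambda>x. frechet_derivative f (at x) v))
     \<Longrightarrow> smooth_map f"

definition vf_apply :: "(real^'n \<Rightarrow> real^'n) \<Rightarrow> (real^'n \<Rightarrow> real) \<Rightarrow> real^'n \<Rightarrow> real" where
  "vf_apply a \<phi> x = frechet_derivative \<phi> (at x) (a x)"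

definition dil :: "('n \<Rightarrow> nat) \<Rightarrow> real \<Rightarrow> real^'n \<Rightarrow> real^'n" where
  "dil \<sigma> lam x = (\<chi> i. lam ^ \<sigma> i * x $ i)"

text \<open>Lie bracket of vector fields: [a,b] phi = a(b phi) - b(a phi).\<close>
definition lie_bracket :: "(real^'n \<Rightarrow> real^'n) \<Rightarrow> (real^'n \<Rightarrow> real^'n) \<Rightarrow> real^'n \<Rightarrow> real^'n" where
  "lie_bracket a b x = frechet_derivative b (at x) (a x) - frechet_derivative a (at x) (b x)"

text \<open>Iterated commutators of X_0..X_(m-1); their values at a point span the values of
  the generated Lie algebra.\<close>
inductive_set commutators :: "(nat \<Rightarrow> real^'n \<Rightarrow> real^'n) \<Rightarrow> nat \<Rightarrow> (real^'n \<Rightarrow> real^'n) set"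
  for X m where
  gen: "j < m \<Longrightarrow> X j \<in> commutators X m"
| br: "a \<in> commutators X m \<Longrightarrow> b \<in> commutators X m \<Longrightarrow> lie_bracket a b \<in> commutators X m"

definition hom_hoermander :: "(nat \<Rightarrow> real^'n \<Rightarrow> real^'n) \<Rightarrow> nat \<Rightarrow> ('n \<Rightarrow> nat) \<Rightarrow> bool" where
  "hom_hoermander X m \<sigma> \<longleftrightarrow>
     (\<forall>j<m. smooth_map (X j)) \<and>
     (\<forall>c::nat \<Rightarrow> real. (\<forall>x. (\<Sum>j<m. c j *\<^sub>R X j x) = 0) \<longrightarrow> (\<forall>j<m. c j = 0)) \<and>
     (\<forall>i. 1 \<le> \<sigma> i) \<and> (\<exists>i. \<sigma> i = 1) \<and>
     (\<forall>j<m. \<forall>\<phi>. smooth_map \<phi> \<longrightarrow> (\<forall>lam>0. \<forall>x.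
         vf_apply (X j) (\<phi> \<circ> dil \<sigma> lam) x = lam * vf_apply (X j) \<phi> (dil \<sigma> lam x))) \<and>
     span {v 0 | v. v \<in> commutators X m} = UNIV"

definition subunit :: "(nat \<Rightarrow> real^'n \<Rightarrow> real^'n) \<Rightarrow> nat \<Rightarrow> real \<Rightarrow> (real \<Rightarrow> real^'n) \<Rightarrow> bool" where
  "subunit X m T \<gamma> \<longleftrightarrow> (\<exists>L. lipschitz_on L {0..T} \<gamma>) \<and>
     (AE t in lebesgue. t \<in> {0..T} \<longrightarrow>
        (\<exists>c::nat \<Rightarrow> real. (\<Sum>j<m. (c j)^2) \<le> 1 \<and>
            (\<gamma> has_vector_derivative (\<Sum>j<m. c j *\<^sub>R X j (\<gamma> t))) (at t within {0..T})))"

definition cc_dist :: "(nat \<Rightarrow> real^'n \<Rightarrow> real^'n) \<Rightarrow> nat \<Rightarrow> real^'n \<Rightarrow> real^'n \<Rightarrow> real" where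
  "cc_dist X m x y = Inf {T. 0 \<le> T \<and> (\<exists>\<gamma>. subunit X m T \<gamma> \<and> \<gamma> 0 = x \<and> \<gamma> T = y)}"

definition cc_ball :: "(nat \<Rightarrow> real^'n \<Rightarrow> real^'n) \<Rightarrow> nat \<Rightarrow> real^'n \<Rightarrow> real \<Rightarrow> (real^'n) set" where
  "cc_ball X m x r = {y. cc_dist X m x y < r}"

definition heat_kernel_props ::
  "(nat \<Rightarrow> real^'n \<Rightarrow> real^'n) \<Rightarrow> nat \<Rightarrow> ('n \<Rightarrow> nat) \<Rightarrow>
   (real \<Rightarrow> real^'n \<Rightarrow> real \<Rightarrow> real^'n \<Rightarrow> real) \<Rightarrow> bool" where
  "heat_kernel_props X m \<sigma> Gam \<longleftrightarrow>
     continuous_on ({0<..} \<times> UNIV \<times> UNIV) (\<lambda>(t, x, y). Gam 0 x t y) \<and>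
     (\<forall>t x s y. 0 \<le> Gam t x s y) \<and>
     (\<forall>t x s y. s \<le> t \<longrightarrow> Gam t x s y = 0) \<and>
     (\<forall>t x y. Gam 0 y t x = Gam 0 x t y) \<and>
     (\<forall>t>0. \<forall>x. (\<integral>\<^sup>+ y. ennreal (Gam 0 y t x) \<partial>lborel) = 1) \<and>
     (\<forall>t>0. \<forall>s>0. \<forall>x y. ennreal (Gam 0 y (t + s) x) =
         (\<integral>\<^sup>+ w. ennreal (Gam 0 w t x * Gam 0 y s w) \<partial>lborel)) \<and>
     (\<exists>\<rho>>1. \<forall>s>0. \<forall>x y.
         1 / (\<rho> * measure lborel (cc_ball X m x (sqrt s))) * exp (- (\<rho> * (cc_dist X m x y)^2 / s))
           \<le> Gam 0 x s y \<and>
         Gam 0 x s y \<le> \<rho> / measure lborel (cc_ball X m x (sqrt s)) * exp (- ((cc_dist X m x y)^2 / (\<rho> * s)))) \<and>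
     (\<exists>c>0. \<forall>x. \<forall>r>0. ennreal (c * r ^ sum \<sigma> UNIV) \<le> emeasure lborel (cc_ball X m x r))"

definition heat_sg :: "(real \<Rightarrow> real^'n \<Rightarrow> real \<Rightarrow> real^'n \<Rightarrow> real) \<Rightarrow> (real^'n \<Rightarrow> real) \<Rightarrow> real \<Rightarrow> real^'n \<Rightarrow> ennreal" where
  "heat_sg Gam u0 t x = (\<integral>\<^sup>+ y. ennreal (Gam 0 y t x * u0 y) \<partial>lborel)"

definition Linf_norm :: "('a \<Rightarrow> ennreal) \<Rightarrow> 'a measure \<Rightarrow> ennreal" where
  "Linf_norm g M = esssup M g"

definition ennpow :: "ennreal \<Rightarrow> real \<Rightarrow> ennreal" where
  "ennpow x a = (if x = top then top else ennreal (enn2real x powr a))"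

end

theory Submission
  imports Defs "HOL-Probability.Probability" "HOL-Real_Asymp.Real_Asymp"
begin

text \<open>
  Write \<open>v(t) = e\<^bsup>t\<L>\<^esup>u\<^sub>0\<close> and \<open>h(t) = \<parallel>v(t)\<parallel>\<^sub>\<infinity>\<^bsup>\<alpha>-1\<^esup>\<close>. If \<open>\<beta>' = A \<beta>\<^sup>\<alpha> h\<close> and \<open>\<beta>(0) = 1\<close>, the bound
  \<open>f(\<beta>v) \<le> A \<beta>\<^sup>\<alpha> h v\<close> together with the semigroup law makes \<open>\<beta>v\<close> a supersolution of the integral equation, and the
  smallness hypothesis says precisely that \<open>\<beta>\<close> stays bounded. The monotone iterates starting from \<open>0\<close> therefore increase to a
  solution \<open>u\<close> with \<open>v \<le> u \<le> Cv\<close>.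

  Continuity in \<open>L\<^sup>\<gamma>\<close> follows from \<open>u(s) = e\<^bsup>(s-a)\<L>\<^esup>u(a) + E(a,s)\<close> with
  \<open>0 \<le> E(a,s) \<le> K (\<integral>\<^sub>a\<^sup>s h) v(s)\<close>, once the semigroup is known to be strongly continuous on \<open>L\<^sup>\<gamma>\<close>. The latter needs
  only that \<open>\<Gamma>(0,x;s,\<cdot>)\<close> concentrates at \<open>x\<close> as \<open>s \<rightarrow> 0\<close>, which the Gaussian bounds give because subunit curves need
  a positive time to leave a Euclidean neighbourhood of \<open>x\<close>.
\<close>

section \<open>Closeness in \<open>L\<^sup>p\<close> for extended nonnegative functions\<close>

text \<open>The nonlinearity is monotone and continuous but not assumed Lipschitz, so the solution
  is produced by monotone convergence and not by contraction; working in \<open>ennreal\<close>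
  gives every integral a meaning before any finiteness is known. The exponent \<alpha> - 1 in
  \<open>h\<close> arises by splitting one factor \<open>v\<close> off the power of order \<alpha>:
  the rest is bounded by \<open>h\<close>, while the semigroup law carries the spare factor from
  time \<tau> to time \<open>t\<close>. Since \<open>h\<close> may blow up at time 0, smallness over
  short time intervals has to come from its integrability, never from a bound on it; and since it is
  merely measurable, the equation for \<beta> is solved in integrated form. On the geometric side
  the Gaussian bounds speak of the control distance, whereas continuity of test functions is
  Euclidean. Moreover, that distance is an infimum over a set which might be empty, so connectivity
  has to be settled before the two can be compared.\<close>

lemma ennpow_ennreal [simp]: "0 \<le> r \<Longrightarrow> ennpow (ennreal r) p = ennreal (r powr p)"
  by (simp add: ennpow_def)

lemma ennpow_top [simp]: "ennpow top p = top"
  by (simp add: ennpow_def)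

lemma ennpow_0 [simp]: "ennpow 0 p = 0"
  by (simp add: ennpow_def)

lemma ennpow_less_top: "a < top \<Longrightarrow> ennpow a p < top"
  by (simp add: ennpow_def less_top[symmetric])

lemma ennpow_mono: "a \<le> b \<Longrightarrow> 0 \<le> p \<Longrightarrow> ennpow a p \<le> ennpow b p"
  by (cases a; cases b) (auto intro!: powr_mono2 simp: top_unique)

lemma measurable_ennpow [measurable (raw)]:
  assumes [measurable]: "f \<in> borel_measurable M"
  shows "(\<lambda>x. ennpow (f x) p) \<in> borel_measurable M"
proof -
  have [measurable]: "Measurable.pred M (\<lambda>x. f x = top)"
    using measurable_sets[OF assms, of "{top}"] by (simp add: pred_def vimage_def Int_def conj_commute)
  show ?thesis unfolding ennpow_def by measurable
qed

lemma ennpow_mult: "0 \<le> c \<Longrightarrow> ennpow (ennreal c * b) p = ennreal (c powr p) * ennpow b p"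
  by (cases b; cases "c = 0")
    (auto simp: ennreal_mult_top powr_mult simp flip: ennreal_mult)

text \<open>From \<open>a + b \<le> 2 * max a b\<close>. The constant \<open>2 powr p\<close> is
  harmless because the errors are eventually made arbitrarily small.\<close>

lemma ennpow_add_le:
  assumes "0 \<le> p"
  shows "ennpow (a + b) p \<le> ennreal (2 powr p) * (ennpow a p + ennpow b p)"
proof -
  have "ennpow (a + b) p \<le> ennpow (ennreal 2 * max a b) p"
    using assms by (intro ennpow_mono) (auto simp: mult_2 max_def intro: add_mono)
  also have "\<dots> = ennreal (2 powr p) * ennpow (max a b) p"
    by (rule ennpow_mult) simp
  also have "\<dots> \<le> ennreal (2 powr p) * (ennpow a p + ennpow b p)"
    by (intro mult_left_mono) (auto simp: max_def)
  finally show ?thesis .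
qed

text \<open>A convex power lies above its tangent at \<open>c\<close>; the inequality is rearranged
  so that no subtraction occurs and it survives the passage to \<open>ennreal\<close>. Young's
  inequality with exponents \<open>p\<close> and \<open>p / (p - 1)\<close> gives the case
  \<open>p > 1\<close>.\<close>

lemma powr_tangent_le:
  fixes z c p :: real
  assumes "1 \<le> p" "0 \<le> z" "0 \<le> c"
  shows "p * c powr (p - 1) * z \<le> z powr p + (p - 1) * c powr p"
proof (cases "p = 1")
  case True
  then show ?thesis using assms by (cases "c = 0") auto
next
  case False
  then have p: "p > 1" using assms by simp
  have "z * c powr (p - 1) \<le> z powr p / p + (c powr (p - 1)) powr (p / (p - 1)) / (p / (p - 1))"
    by (rule Youngs_inequality) (use p assms in \<open>auto simp: field_simps\<close>)
  also have "(c powr (p - 1)) powr (p / (p - 1)) = c powr p"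
    using p by (simp add: powr_powr)
  finally have "p * (z * c powr (p - 1)) \<le> p * (z powr p / p + c powr p / (p / (p - 1)))"
    using p by (intro mult_left_mono) auto
  also have "\<dots> = z powr p + (p - 1) * c powr p"
    using p by (simp add: distrib_left)
  finally show ?thesis by (simp add: ac_simps)
qed

lemma powr_tangent_ennpow_le:
  assumes "1 \<le> p" "0 \<le> c"
  shows "ennreal (p * c powr (p - 1)) * z \<le> ennpow z p + ennreal ((p - 1) * c powr p)"
proof (cases z)
  case (real r)
  then show ?thesis using powr_tangent_le[OF assms(1) real(1) assms(2)] assms
    by (simp flip: ennreal_mult ennreal_plus)
qed simp

text \<open>Bounding both functions by each other plus an error term avoids the truncated subtraction
  of \<^typ>\<open>ennreal\<close>.\<close>
definition Lp_close :: "real \<Rightarrow> ('a::euclidean_space \<Rightarrow> ennreal) \<Rightarrow> ('a \<Rightarrow> ennreal) \<Rightarrow> ennreal \<Rightarrow> bool" where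
  "Lp_close p a b \<epsilon> \<longleftrightarrow> (\<exists>e\<in>borel_measurable borel.
     (AE x in lborel. a x \<le> b x + e x \<and> b x \<le> a x + e x) \<and> (\<integral>\<^sup>+ x. ennpow (e x) p \<partial>lborel) \<le> \<epsilon>)"

lemma Lp_closeI:
  assumes "e \<in> borel_measurable borel" "AE x in lborel. a x \<le> b x + e x \<and> b x \<le> a x + e x"
    "(\<integral>\<^sup>+ x. ennpow (e x) p \<partial>lborel) \<le> \<epsilon>"
  shows "Lp_close p a b \<epsilon>"
  using assms unfolding Lp_close_def by blast

lemma Lp_closeE:
  assumes "Lp_close p a b \<epsilon>"
  obtains e where "e \<in> borel_measurable borel" "AE x in lborel. a x \<le> b x + e x \<and> b x \<le> a x + e x"
    "(\<integral>\<^sup>+ x. ennpow (e x) p \<partial>lborel) \<le> \<epsilon>"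
  using assms unfolding Lp_close_def by (elim bexE conjE)

lemma Lp_close_sym: "Lp_close p a b \<epsilon> \<Longrightarrow> Lp_close p b a \<epsilon>"
  unfolding Lp_close_def by (simp add: conj_commute)

lemma Lp_close_trans:
  assumes p: "0 \<le> p" and "Lp_close p a b \<epsilon>1" "Lp_close p b c \<epsilon>2"
  shows "Lp_close p a c (ennreal (2 powr p) * (\<epsilon>1 + \<epsilon>2))"
proof -
  obtain e1 where [measurable]: "e1 \<in> borel_measurable borel"
    and ae1: "AE x in lborel. a x \<le> b x + e1 x \<and> b x \<le> a x + e1 x"
    and int1: "(\<integral>\<^sup>+ x. ennpow (e1 x) p \<partial>lborel) \<le> \<epsilon>1"
    by (rule Lp_closeE[OF assms(2)]) (rule that)
  obtain e2 where [measurable]: "e2 \<in> borel_measurable borel"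
    and ae2: "AE x in lborel. b x \<le> c x + e2 x \<and> c x \<le> b x + e2 x"
    and int2: "(\<integral>\<^sup>+ x. ennpow (e2 x) p \<partial>lborel) \<le> \<epsilon>2"
    by (rule Lp_closeE[OF assms(3)]) (rule that)
  show ?thesis
  proof (rule Lp_closeI[of "\<lambda>x. e1 x + e2 x"])
    show "AE x in lborel. a x \<le> c x + (e1 x + e2 x) \<and> c x \<le> a x + (e1 x + e2 x)"
      using ae1 ae2
    proof eventually_elim
      case (elim x)
      have "a x \<le> (c x + e2 x) + e1 x"
        using order_trans[OF conjunct1[OF elim(1)] add_right_mono[OF conjunct1[OF elim(2)]]] .
      moreover have "c x \<le> (a x + e1 x) + e2 x"
        using order_trans[OF conjunct2[OF elim(2)] add_right_mono[OF conjunct2[OF elim(1)]]] .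
      ultimately show ?case by (simp add: ac_simps)
    qed
    have "(\<integral>\<^sup>+ x. ennpow (e1 x + e2 x) p \<partial>lborel)
        \<le> (\<integral>\<^sup>+ x. ennreal (2 powr p) * (ennpow (e1 x) p + ennpow (e2 x) p) \<partial>lborel)"
      by (intro nn_integral_mono ennpow_add_le p)
    also have "\<dots> = ennreal (2 powr p) * ((\<integral>\<^sup>+ x. ennpow (e1 x) p \<partial>lborel) + (\<integral>\<^sup>+ x. ennpow (e2 x) p \<partial>lborel))"
      by (simp add: nn_integral_cmult nn_integral_add)
    also have "\<dots> \<le> ennreal (2 powr p) * (\<epsilon>1 + \<epsilon>2)"
      using int1 int2 by (intro mult_left_mono add_mono) auto
    finally show "(\<integral>\<^sup>+ x. ennpow (e1 x + e2 x) p \<partial>lborel) \<le> ennreal (2 powr p) * (\<epsilon>1 + \<epsilon>2)" .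
  qed simp
qed

lemma Lp_close_refl: "Lp_close p a a \<epsilon>"
  by (rule Lp_closeI[of "\<lambda>_. 0"]) simp_all

text \<open>Packages the three-step approximation arguments; \<open>\<delta>\<close> has to be fixed
  before the functions are known, hence the rule inside the conclusion.\<close>

lemma Lp_close_trans3:
  assumes p: "0 \<le> p" and eps: "0 < \<epsilon>"
  obtains \<delta> where "0 < \<delta>"
    "\<And>a b c d :: 'a::euclidean_space \<Rightarrow> ennreal. \<lbrakk>Lp_close p a b (ennreal \<delta>); Lp_close p b c (ennreal \<delta>);
      Lp_close p c d (ennreal \<delta>)\<rbrakk> \<Longrightarrow> Lp_close p a d (ennreal \<epsilon>)"
proof -
  define c where "c = (2::real) powr p"
  have c: "1 \<le> c" using p by (simp add: c_def ge_one_powr_ge_zero)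
  have D: "1 \<le> c * (c * 2 + 1)" using c mult_mono[of 1 c 1 "c * 2 + 1"] by simp
  \<comment> \<open>Two uses of transitivity turn three errors \<open>\<delta>\<close> into
    \<open>c * (c * (\<delta> + \<delta>) + \<delta>)\<close>, which this choice makes equal to
    \<open>\<epsilon>\<close>.\<close>
  define \<delta> where "\<delta> = \<epsilon> / (c * (c * 2 + 1))"
  have \<delta>: "0 < \<delta>" using eps D by (simp add: \<delta>_def)
  show ?thesis
  proof (rule that[OF \<delta>])
    fix a b c' d :: "'a \<Rightarrow> ennreal"
    assume cl: "Lp_close p a b (ennreal \<delta>)" "Lp_close p b c' (ennreal \<delta>)" "Lp_close p c' d (ennreal \<delta>)"
    have "ennreal c * (ennreal c * (ennreal \<delta> + ennreal \<delta>) + ennreal \<delta>) = ennreal (c * (c * (\<delta> + \<delta>) + \<delta>))"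
      using \<delta> c by (simp flip: ennreal_mult ennreal_plus)
    also have "c * (c * (\<delta> + \<delta>) + \<delta>) = \<delta> * (c * (c * 2 + 1))" by (simp add: algebra_simps)
    also have "\<dots> = \<epsilon>" unfolding \<delta>_def by (rule nonzero_eq_divide_eq[THEN iffD1, OF _ refl]) (use D in auto)
    finally show "Lp_close p a d (ennreal \<epsilon>)"
      using Lp_close_trans[OF p Lp_close_trans[OF p cl(1,2)] cl(3)] by (simp add: c_def)
  qed
qed

lemma Lp_close_realI:
  fixes a b :: "'a::euclidean_space \<Rightarrow> real"
  assumes [measurable]: "a \<in> borel_measurable borel" "b \<in> borel_measurable borel"
    and nn: "\<And>x. 0 \<le> a x" "\<And>x. 0 \<le> b x"
    and int: "(\<integral>\<^sup>+ x. ennreal (\<bar>a x - b x\<bar> powr p) \<partial>lborel) \<le> \<epsilon>"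
  shows "Lp_close p (\<lambda>x. ennreal (a x)) (\<lambda>x. ennreal (b x)) \<epsilon>"
proof (rule Lp_closeI[of "\<lambda>x. ennreal \<bar>a x - b x\<bar>"])
  show "AE x in lborel. ennreal (a x) \<le> ennreal (b x) + ennreal \<bar>a x - b x\<bar> \<and>
      ennreal (b x) \<le> ennreal (a x) + ennreal \<bar>a x - b x\<bar>"
    using nn by (intro AE_I2) (auto simp flip: ennreal_plus intro!: ennreal_leI)
  show "(\<integral>\<^sup>+ x. ennpow (ennreal \<bar>a x - b x\<bar>) p \<partial>lborel) \<le> \<epsilon>" using int by simp
qed simp

lemma Lp_close_realD:
  fixes a b :: "'a::euclidean_space \<Rightarrow> real"
  assumes cl: "Lp_close p (\<lambda>x. ennreal (a x)) (\<lambda>x. ennreal (b x)) \<epsilon>"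
    and nn: "\<And>x. 0 \<le> a x" "\<And>x. 0 \<le> b x" and p: "0 \<le> p"
  shows "(\<integral>\<^sup>+ x. ennreal (\<bar>a x - b x\<bar> powr p) \<partial>lborel) \<le> \<epsilon>"
proof -
  obtain e where e: "AE x in lborel. ennreal (a x) \<le> ennreal (b x) + e x \<and> ennreal (b x) \<le> ennreal (a x) + e x"
    and int: "(\<integral>\<^sup>+ x. ennpow (e x) p \<partial>lborel) \<le> \<epsilon>"
    by (rule Lp_closeE[OF cl]) (rule that)
  have "(\<integral>\<^sup>+ x. ennreal (\<bar>a x - b x\<bar> powr p) \<partial>lborel) \<le> (\<integral>\<^sup>+ x. ennpow (e x) p \<partial>lborel)"
  proof (rule nn_integral_mono_AE)
    show "AE x in lborel. ennreal (\<bar>a x - b x\<bar> powr p) \<le> ennpow (e x) p"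
      using e
    proof eventually_elim
      case (elim x)
      show ?case
      proof (cases "e x")
        case (real r)
        then have "\<bar>a x - b x\<bar> \<le> r"
          using elim nn[of x] by (auto simp flip: ennreal_plus)
        then show ?thesis using real p by (auto intro!: ennreal_leI powr_mono2)
      qed simp
    qed
  qed
  then show ?thesis using int by simp
qed

text \<open>Truncation by height and by a continuous cutoff, followed by an almost-everywhere
  approximation by continuous functions.\<close>
lemma Lp_approx_continuous:
  fixes g :: "'a::euclidean_space \<Rightarrow> real"
  assumes [measurable]: "g \<in> borel_measurable borel" and nn: "\<And>x. 0 \<le> g x" and p: "0 < p"
    and fin: "(\<integral>\<^sup>+ x. ennreal (g x powr p) \<partial>lborel) < \<infinity>" and eps: "0 < \<epsilon>"
  obtains \<phi> K where "continuous_on UNIV \<phi>" "\<And>x. 0 \<le> \<phi> x" "\<And>x. \<phi> x \<le> K" "0 < K"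
    "(\<integral>\<^sup>+ x. ennreal (\<phi> x) \<partial>lborel) < \<infinity>"
    "Lp_close p (\<lambda>x. ennreal (g x)) (\<lambda>x. ennreal (\<phi> x)) (ennreal \<epsilon>)"
proof -
  \<comment> \<open>Two approximations of cost \<open>\<epsilon>'\<close> will be chained by
    transitivity, whose factor is \<open>2 powr p\<close>.\<close>
  define \<epsilon>' where "\<epsilon>' = \<epsilon> / (2 * 2 powr p)"
  have eps': "\<epsilon>' > 0" using eps by (simp add: \<epsilon>'_def)
  define cut where "cut k x = max 0 (min 1 (real k + 1 - norm x))" for k :: nat and x :: 'a
  have chi: "0 \<le> cut k x" "cut k x \<le> 1" for k x by (auto simp: cut_def)
  have [measurable]: "cut k \<in> borel_measurable borel" for k unfolding cut_def by measurable
  have chic: "continuous_on UNIV (cut k)" for k unfolding cut_def by (intro continuous_intros)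
  have chi0: "cut k x = 0" if "x \<notin> cball 0 (real k + 1)" for k x using that by (auto simp: cut_def)
  define G where "G k x = min (g x) (real k) * cut k x" for k x
  have G: "0 \<le> G k x" "G k x \<le> g x" for k x
    using nn[of x] chi[where k=k and x=x] mult_mono[of "min (g x) (real k)" "g x" "cut k x" 1]
    by (auto simp: G_def)
  have [measurable]: "G k \<in> borel_measurable borel" for k unfolding G_def by measurable
  have Glim: "(\<lambda>k. G k x) \<longlonglongrightarrow> g x" for x
  proof (rule tendsto_eventually)
    obtain k0 :: nat where "max (g x) (norm x) \<le> real k0" using real_arch_simple by blast
    then show "\<forall>\<^sub>F k in sequentially. G k x = g x"
      by (intro eventually_sequentiallyI[of k0]) (auto simp: G_def cut_def)
  qed
  have "(\<lambda>k. \<integral>\<^sup>+ x. ennreal (\<bar>g x - G k x\<bar> powr p) \<partial>lborel) \<longlonglongrightarrow> (\<integral>\<^sup>+ x. 0 \<partial>(lborel :: 'a measure))"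
  proof (rule nn_integral_dominated_convergence[where w="\<lambda>x. ennreal (g x powr p)"])
    show "AE x in lborel. ennreal (\<bar>g x - G k x\<bar> powr p) \<le> ennreal (g x powr p)" for k
    proof (intro AE_I2 ennreal_leI powr_mono2)
      fix x show "\<bar>g x - G k x\<bar> \<le> g x" using G[of k x] nn[of x] by auto
    qed (use p in auto)
    show "AE x in lborel. (\<lambda>k. ennreal (\<bar>g x - G k x\<bar> powr p)) \<longlonglongrightarrow> 0"
    proof (intro AE_I2)
      fix x
      have "(\<lambda>k. \<bar>g x - G k x\<bar>) \<longlonglongrightarrow> \<bar>g x - g x\<bar>" by (intro tendsto_intros Glim)
      then have "(\<lambda>k. \<bar>g x - G k x\<bar>) \<longlonglongrightarrow> 0" by simp
      then have "(\<lambda>k. \<bar>g x - G k x\<bar> powr p) \<longlonglongrightarrow> 0"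
        by (rule tendsto_zero_powrI[where b=p]) (use p in auto)
      from tendsto_ennrealI[OF this] show "(\<lambda>k. ennreal (\<bar>g x - G k x\<bar> powr p)) \<longlonglongrightarrow> 0" by simp
    qed
  qed (use fin in auto)
  then have "(\<lambda>k. \<integral>\<^sup>+ x. ennreal (\<bar>g x - G k x\<bar> powr p) \<partial>lborel) \<longlonglongrightarrow> 0" by simp
  then have "\<forall>\<^sub>F k in sequentially. (\<integral>\<^sup>+ x. ennreal (\<bar>g x - G k x\<bar> powr p) \<partial>lborel) < ennreal \<epsilon>'"
    by (rule order_tendstoD(2)) (use eps' in auto)
  then have "\<forall>\<^sub>F k in sequentially. 1 \<le> k \<and> (\<integral>\<^sup>+ x. ennreal (\<bar>g x - G k x\<bar> powr p) \<partial>lborel) < ennreal \<epsilon>'"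
    using eventually_ge_at_top[of 1] by eventually_elim auto
  then obtain k where k: "1 \<le> k" "(\<integral>\<^sup>+ x. ennreal (\<bar>g x - G k x\<bar> powr p) \<partial>lborel) < ennreal \<epsilon>'"
    using eventually_sequentially by auto
  have c1: "Lp_close p (\<lambda>x. ennreal (g x)) (\<lambda>x. ennreal (G k x)) (ennreal \<epsilon>')"
    by (rule Lp_close_realI) (use nn G k in auto)
  have "g \<in> borel_measurable (lebesgue_on UNIV)"
    by (simp add: measurable_completion lebesgue_on_UNIV_eq)
  then have "g measurable_on UNIV"
    using measurable_on_iff_borel_measurable[of UNIV g] by simp
  then obtain N h where N: "negligible N" and hc: "\<And>n. continuous_on UNIV (h n)"
    and hl: "\<And>x. x \<notin> N \<Longrightarrow> (\<lambda>n. h n x) \<longlonglongrightarrow> g x"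
    unfolding measurable_on_def by auto
  have [measurable]: "h n \<in> borel_measurable borel" for n
    by (rule borel_measurable_continuous_onI[OF hc])
  \<comment> \<open>The approximants get the same height and cutoff as \<open>G k\<close>: both
    vanish outside one ball and take values in \<open>{0..k}\<close>, which provides the dominating
    function.\<close>
  define \<phi> where "\<phi> n x = min (max 0 (h n x)) (real k) * cut k x" for n x
  have phi: "0 \<le> \<phi> n x" "\<phi> n x \<le> real k" for n x
    using chi[where k=k and x=x] mult_mono[of "min (max 0 (h n x)) (real k)" "real k" "cut k x" 1]
    by (auto simp: \<phi>_def)
  have phic: "continuous_on UNIV (\<phi> n)" for n
    unfolding \<phi>_def by (intro continuous_intros hc chic)
  have [measurable]: "\<phi> n \<in> borel_measurable borel" for n unfolding \<phi>_def by measurable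
  have "(\<lambda>n. \<integral>\<^sup>+ x. ennreal (\<bar>G k x - \<phi> n x\<bar> powr p) \<partial>lborel) \<longlonglongrightarrow> (\<integral>\<^sup>+ x. 0 \<partial>(lborel :: 'a measure))"
  proof (rule nn_integral_dominated_convergence[where w="\<lambda>x. ennreal (real k powr p) * indicator (cball 0 (real k + 1)) x"])
    show "AE x in lborel. ennreal (\<bar>G k x - \<phi> n x\<bar> powr p) \<le> ennreal (real k powr p) * indicator (cball 0 (real k + 1)) x" for n
    proof (intro AE_I2)
      fix x
      have "G k x \<le> real k"
        using mult_mono[of "min (g x) (real k)" "real k" "cut k x" 1] chi[where k=k and x=x] by (auto simp: G_def)
      then have "\<bar>G k x - \<phi> n x\<bar> \<le> real k" using G(1)[of k x] phi[of n x] by linarith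
      moreover have "G k x = 0 \<and> \<phi> n x = 0" if "x \<notin> cball 0 (real k + 1)"
        using chi0[OF that] by (simp add: G_def \<phi>_def)
      ultimately show "ennreal (\<bar>G k x - \<phi> n x\<bar> powr p) \<le> ennreal (real k powr p) * indicator (cball 0 (real k + 1)) x"
        using p by (cases "x \<in> cball 0 (real k + 1)") (auto intro!: ennreal_leI powr_mono2)
    qed
    show "(\<lambda>x. ennreal (\<bar>G k x - \<phi> n x\<bar> powr p)) \<in> borel_measurable lborel" for n
      by simp
    show "(\<lambda>x. ennreal (real k powr p) * indicator (cball (0::'a) (real k + 1)) x) \<in> borel_measurable lborel"
      by (intro borel_measurable_times_ennreal borel_measurable_const borel_measurable_indicator) simp
    have "emeasure lborel (cball (0::'a) (real k + 1)) < \<infinity>"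
      by (rule emeasure_bounded_finite) simp
    then show "(\<integral>\<^sup>+ x. ennreal (real k powr p) * indicator (cball (0::'a) (real k + 1)) x \<partial>lborel) < \<infinity>"
      by (simp add: nn_integral_cmult_indicator ennreal_mult_less_top)
    have "AE x in lebesgue. x \<notin> N"
      using N by (intro AE_not_in) (simp add: negligible_iff_null_sets)
    then have "AE x in lborel. x \<notin> N" by (simp add: AE_completion_iff)
    then show "AE x in lborel. (\<lambda>n. ennreal (\<bar>G k x - \<phi> n x\<bar> powr p)) \<longlonglongrightarrow> 0"
    proof eventually_elim
      case (elim x)
      have "(\<lambda>n. \<bar>G k x - \<phi> n x\<bar>) \<longlonglongrightarrow> \<bar>G k x - min (max 0 (g x)) (real k) * cut k x\<bar>"
        unfolding \<phi>_def by (intro tendsto_intros hl elim)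
      then have "(\<lambda>n. \<bar>G k x - \<phi> n x\<bar>) \<longlonglongrightarrow> 0" using nn[of x] by (simp add: G_def)
      then have "(\<lambda>n. \<bar>G k x - \<phi> n x\<bar> powr p) \<longlonglongrightarrow> 0"
        by (rule tendsto_zero_powrI[where b=p]) (use p in auto)
      from tendsto_ennrealI[OF this] show ?case by simp
    qed
  qed simp
  then have "(\<lambda>n. \<integral>\<^sup>+ x. ennreal (\<bar>G k x - \<phi> n x\<bar> powr p) \<partial>lborel) \<longlonglongrightarrow> 0" by simp
  then have "\<forall>\<^sub>F n in sequentially. (\<integral>\<^sup>+ x. ennreal (\<bar>G k x - \<phi> n x\<bar> powr p) \<partial>lborel) < ennreal \<epsilon>'"
    by (rule order_tendstoD(2)) (use eps' in auto)
  then obtain n where n: "(\<integral>\<^sup>+ x. ennreal (\<bar>G k x - \<phi> n x\<bar> powr p) \<partial>lborel) < ennreal \<epsilon>'"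
    using eventually_sequentially by auto
  have c2: "Lp_close p (\<lambda>x. ennreal (G k x)) (\<lambda>x. ennreal (\<phi> n x)) (ennreal \<epsilon>')"
    by (rule Lp_close_realI) (use phi G n in auto)
  show ?thesis
  proof (rule that)
    show "continuous_on UNIV (\<phi> n)" by (rule phic)
    show "0 \<le> \<phi> n x" "\<phi> n x \<le> real k" for x using phi by auto
    show "0 < real k" using k by simp
    have "ennreal (2 powr p) * (ennreal \<epsilon>' + ennreal \<epsilon>') = ennreal \<epsilon>"
      using eps by (simp add: \<epsilon>'_def flip: ennreal_plus ennreal_mult)
    then show "Lp_close p (\<lambda>x. ennreal (g x)) (\<lambda>x. ennreal (\<phi> n x)) (ennreal \<epsilon>)"
      using Lp_close_trans[OF _ c1 c2] p by simp
    have "(\<integral>\<^sup>+ x. ennreal (\<phi> n x) \<partial>lborel) \<le> (\<integral>\<^sup>+ x. ennreal (real k) * indicator (cball (0::'a) (real k + 1)) x \<partial>lborel)"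
    proof (rule nn_integral_mono)
      fix x :: 'a
      show "ennreal (\<phi> n x) \<le> ennreal (real k) * indicator (cball 0 (real k + 1)) x"
        using phi[of n x] chi0[of x k]
        by (cases "x \<in> cball 0 (real k + 1)") (auto simp: \<phi>_def[of n x] intro!: ennreal_leI)
    qed
    also have "\<dots> < \<infinity>"
      using emeasure_bounded_finite[of "cball (0::'a) (real k + 1)"]
      by (simp add: nn_integral_cmult_indicator ennreal_mult_less_top)
    finally show "(\<integral>\<^sup>+ x. ennreal (\<phi> n x) \<partial>lborel) < \<infinity>" .
  qed
qed

section \<open>Symmetric Markov semigroups on \<open>L\<^sup>p\<close>\<close>

text \<open>Isolates what the argument takes from the kernel; the geometry enters only through
  \<open>kernel_tail\<close>. As the kernel vanishes for \<open>t \<le> 0\<close>, the operator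
  \<open>sg 0\<close> is zero and not the identity, so endpoints of time intervals need care
  throughout.\<close>

locale symmetric_heat_kernel =
  fixes P :: "real \<Rightarrow> 'a::euclidean_space \<Rightarrow> 'a \<Rightarrow> ennreal"
  assumes kernel_measurable: "(\<lambda>(t, x, y). P t x y) \<in> borel_measurable (borel \<Otimes>\<^sub>M borel \<Otimes>\<^sub>M borel)"
    and kernel_nonpos: "t \<le> 0 \<Longrightarrow> P t x y = 0"
    and kernel_sym: "P t x y = P t y x"
    and kernel_mass: "0 < t \<Longrightarrow> (\<integral>\<^sup>+ y. P t x y \<partial>lborel) = 1"
    and kernel_semigroup: "0 < t \<Longrightarrow> 0 < s \<Longrightarrow> P (t + s) x y = (\<integral>\<^sup>+ w. P t x w * P s w y \<partial>lborel)"
    and kernel_tail: "0 < e \<Longrightarrow>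
      ((\<lambda>t. \<integral>\<^sup>+ y. P t x y * indicator {y. e \<le> dist x y} y \<partial>lborel) \<longlongrightarrow> 0) (at_right 0)"
begin

lemma measurable_kernel [measurable (raw)]:
  assumes [measurable]: "f \<in> borel_measurable M" "g \<in> borel_measurable M" "h \<in> borel_measurable M"
  shows "(\<lambda>z. P (f z) (g z) (h z)) \<in> borel_measurable M"
proof -
  have "(\<lambda>z. (f z, g z, h z)) \<in> M \<rightarrow>\<^sub>M borel \<Otimes>\<^sub>M borel \<Otimes>\<^sub>M borel" by measurable
  from measurable_compose[OF this kernel_measurable] show ?thesis by simp
qed

definition sg :: "real \<Rightarrow> ('a \<Rightarrow> ennreal) \<Rightarrow> 'a \<Rightarrow> ennreal" where
  "sg t g x = (\<integral>\<^sup>+ y. P t x y * g y \<partial>lborel)"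

lemma measurable_sg [measurable (raw)]:
  assumes [measurable]: "f \<in> borel_measurable M" "h \<in> borel_measurable M"
    "(\<lambda>(z, y). g z y) \<in> borel_measurable (M \<Otimes>\<^sub>M borel)"
  shows "(\<lambda>z. sg (f z) (g z) (h z)) \<in> borel_measurable M"
  unfolding sg_def by measurable

lemma measurable_sg' [measurable]:
  assumes [measurable]: "g \<in> borel_measurable borel"
  shows "sg t g \<in> borel_measurable borel"
  unfolding sg_def by measurable

lemma sg_nonpos: "t \<le> 0 \<Longrightarrow> sg t g x = 0"
  by (simp add: sg_def kernel_nonpos)

lemma sg_mono_AE: "AE y in lborel. g y \<le> h y \<Longrightarrow> sg t g x \<le> sg t h x"
  unfolding sg_def by (rule nn_integral_mono_AE) (auto elim!: eventually_mono intro: mult_left_mono)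

lemma sg_add:
  assumes [measurable]: "g \<in> borel_measurable borel" "h \<in> borel_measurable borel"
  shows "sg t (\<lambda>y. g y + h y) x = sg t g x + sg t h x"
  unfolding sg_def by (simp add: distrib_left nn_integral_add)

lemma sg_cmult:
  assumes [measurable]: "g \<in> borel_measurable borel"
  shows "sg t (\<lambda>y. c * g y) x = c * sg t g x"
  unfolding sg_def by (simp add: mult.left_commute[of _ c] nn_integral_cmult)

lemma sg_const: "0 < t \<Longrightarrow> sg t (\<lambda>y. c) x = c"
  unfolding sg_def by (simp add: nn_integral_multc kernel_mass)

lemma sg_sg:
  assumes [measurable]: "g \<in> borel_measurable borel" and ts: "0 < t" "0 < s"
  shows "sg t (sg s g) x = sg (t + s) g x"
proof -
  have "sg (t + s) g x = (\<integral>\<^sup>+ y. (\<integral>\<^sup>+ w. P t x w * P s w y * g y \<partial>lborel) \<partial>lborel)"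
    unfolding sg_def by (simp add: kernel_semigroup ts nn_integral_multc)
  also have "\<dots> = (\<integral>\<^sup>+ w. (\<integral>\<^sup>+ y. P t x w * P s w y * g y \<partial>lborel) \<partial>lborel)"
    by (rule lborel_pair.Fubini') measurable
  also have "\<dots> = sg t (sg s g) x"
    unfolding sg_def by (simp add: mult.assoc nn_integral_cmult)
  finally show ?thesis ..
qed

text \<open>Tonelli and the symmetry of the kernel turn unit mass in one variable into unit mass in
  the other.\<close>

lemma nn_integral_sg:
  assumes [measurable]: "g \<in> borel_measurable borel" and t: "0 < t"
  shows "(\<integral>\<^sup>+ x. sg t g x \<partial>lborel) = (\<integral>\<^sup>+ y. g y \<partial>lborel)"
proof -
  have "(\<integral>\<^sup>+ x. sg t g x \<partial>lborel) = (\<integral>\<^sup>+ y. (\<integral>\<^sup>+ x. P t y x * g y \<partial>lborel) \<partial>lborel)"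
    unfolding sg_def by (subst lborel_pair.Fubini') (auto simp: kernel_sym)
  also have "\<dots> = (\<integral>\<^sup>+ y. g y \<partial>lborel)"
    by (simp add: nn_integral_multc kernel_mass t)
  finally show ?thesis .
qed

text \<open>Jensen's inequality for the probability density \<open>P t x\<close>: integrate the
  tangent inequality at a level \<open>c\<close> not above the mean and cancel the finite constant
  \<open>(p - 1) * c powr p\<close>. Letting \<open>c\<close> vary, instead of taking the mean
  itself, also covers an infinite mean.\<close>

lemma sg_jensen:
  assumes [measurable]: "g \<in> borel_measurable borel" and t: "0 < t" and p: "1 \<le> p"
  shows "ennpow (sg t g x) p \<le> sg t (\<lambda>y. ennpow (g y) p) x"
proof -
  let ?I = "sg t (\<lambda>y. ennpow (g y) p) x"
  have *: "ennreal (c powr p) \<le> ?I" if c: "0 \<le> c" "ennreal c \<le> sg t g x" for c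
  proof -
    have "ennreal (c powr p) + ennreal ((p - 1) * c powr p) = ennreal (p * c powr (p - 1) * c)"
    proof (cases "c = 0")
      case False
      then have "c powr p = c powr (p - 1) * c" using c powr_mult_base[of c "p - 1"] by (simp add: mult.commute)
      then have "c powr p + (p - 1) * c powr p = p * c powr (p - 1) * c" by (simp add: algebra_simps)
      then show ?thesis using p c ennreal_plus[of "c powr p" "(p - 1) * c powr p"] by simp
    qed simp
    also have "\<dots> = ennreal (p * c powr (p - 1)) * ennreal c"
      using p c by (intro ennreal_mult) auto
    also have "\<dots> \<le> ennreal (p * c powr (p - 1)) * sg t g x"
      using c by (intro mult_left_mono) auto
    also have "\<dots> = sg t (\<lambda>y. ennreal (p * c powr (p - 1)) * g y) x"
      by (simp add: sg_cmult)
    also have "\<dots> \<le> sg t (\<lambda>y. ennpow (g y) p + ennreal ((p - 1) * c powr p)) x"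
      by (intro sg_mono_AE AE_I2 powr_tangent_ennpow_le p c)
    also have "\<dots> = ?I + ennreal ((p - 1) * c powr p)"
      by (simp add: sg_add sg_const t)
    finally show ?thesis by (simp add: add.commute[of _ "ennreal ((p - 1) * c powr p)"] ennreal_add_left_cancel_le)
  qed
  show ?thesis
  proof (cases "sg t g x")
    case (real r)
    then show ?thesis using *[of r] by simp
  next
    case top
    have "of_nat n \<le> ?I" for n :: nat
    proof (cases "n = 0")
      case False
      have "real n powr 1 \<le> real n powr p" using False p by (intro powr_mono) auto
      then have "ennreal (real n) \<le> ennreal (real n powr p)" by (intro ennreal_leI) auto
      also have "\<dots> \<le> ?I" by (rule *) (auto simp: top)
      finally show ?thesis by (simp add: ennreal_of_nat_eq_real_of_nat)
    qed simp
    then have "(SUP n. of_nat n) \<le> ?I" by (rule SUP_least)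
    then have "?I = top" by (simp add: ennreal_SUP_of_nat_eq_top top_unique)
    then show ?thesis by simp
  qed
qed

text \<open>The semigroup is a contraction: monotonicity and additivity carry the error function
  through, and Jensen's inequality with conservation of mass bounds its size.\<close>

lemma Lp_close_sg:
  assumes [measurable]: "a \<in> borel_measurable borel" "b \<in> borel_measurable borel"
    and t: "0 < t" and p: "1 \<le> p" and cl: "Lp_close p a b \<epsilon>"
  shows "Lp_close p (sg t a) (sg t b) \<epsilon>"
proof -
  obtain e where [measurable]: "e \<in> borel_measurable borel"
    and e: "AE x in lborel. a x \<le> b x + e x \<and> b x \<le> a x + e x"
    and int: "(\<integral>\<^sup>+ x. ennpow (e x) p \<partial>lborel) \<le> \<epsilon>"
    by (rule Lp_closeE[OF cl]) (rule that)
  show ?thesis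
  proof (rule Lp_closeI[of "sg t e"])
    have "sg t a x \<le> sg t (\<lambda>y. b y + e y) x" "sg t b x \<le> sg t (\<lambda>y. a y + e y) x" for x
      using e by (auto intro!: sg_mono_AE)
    then show "AE x in lborel. sg t a x \<le> sg t b x + sg t e x \<and> sg t b x \<le> sg t a x + sg t e x"
      by (simp add: sg_add)
    have "(\<integral>\<^sup>+ x. ennpow (sg t e x) p \<partial>lborel) \<le> (\<integral>\<^sup>+ x. sg t (\<lambda>y. ennpow (e y) p) x \<partial>lborel)"
      by (intro nn_integral_mono sg_jensen t p) simp
    also have "\<dots> \<le> \<epsilon>" using int by (simp add: nn_integral_sg t)
    finally show "(\<integral>\<^sup>+ x. ennpow (sg t e x) p \<partial>lborel) \<le> \<epsilon>" .
  qed simp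
qed

lemma sg_tendsto_pointwise:
  assumes cont: "continuous_on UNIV \<phi>" and nn: "\<And>y. 0 \<le> \<phi> y" and le: "\<And>y. \<phi> y \<le> K"
  shows "((\<lambda>t. enn2real (sg t (\<lambda>y. ennreal (\<phi> y)) x)) \<longlongrightarrow> \<phi> x) (at_right 0)"
proof (rule tendstoI)
  fix r :: real assume r: "0 < r"
  have [measurable]: "\<phi> \<in> borel_measurable borel" by (rule borel_measurable_continuous_onI[OF cont])
  have K: "0 \<le> K" using nn le order_trans by blast
  obtain d where d: "d > 0" "\<And>y. dist y x < d \<Longrightarrow> dist (\<phi> y) (\<phi> x) < r / 3"
    using cont r unfolding continuous_on_iff by (metis UNIV_I zero_less_divide_iff zero_less_numeral)
  define T where "T t = (\<integral>\<^sup>+ y. P t x y * indicator {y. d \<le> dist x y} y \<partial>lborel)" for t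
  have Tsg: "T t = sg t (indicator {y. d \<le> dist x y}) x" for t by (simp add: T_def sg_def)
  have "(T \<longlongrightarrow> 0) (at_right 0)" unfolding T_def by (rule kernel_tail[OF d(1)])
  \<comment> \<open>Writing \<open>K + 1\<close> in place of \<open>K\<close> keeps the quotient
    meaningful for \<open>K = 0\<close>.\<close>
  then have "\<forall>\<^sub>F t in at_right 0. T t < ennreal (r / (3 * (K + 1)))"
    by (rule order_tendstoD(2)) (use r K in auto)
  moreover have "\<forall>\<^sub>F t in at_right (0::real). 0 < t" by (rule eventually_at_right_less)
  ultimately show "\<forall>\<^sub>F t in at_right 0. dist (enn2real (sg t (\<lambda>y. ennreal (\<phi> y)) x)) (\<phi> x) < r"
  proof eventually_elim
    case (elim t)
    \<comment> \<open>\<open>E\<close> dominates the oscillation of \<open>\<phi>\<close> around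
      \<open>x\<close>: continuity controls it nearby, the bound \<open>K\<close> far away, and the
      far part carries little mass.\<close>
    define E where "E y = ennreal (r / 3) + ennreal K * indicator {y. d \<le> dist x y} y" for y
    have [measurable]: "E \<in> borel_measurable borel" unfolding E_def by measurable
    have sE: "sg t E x = ennreal (r / 3) + ennreal K * T t"
      unfolding E_def Tsg by (simp add: sg_add sg_cmult sg_const elim)
    have "ennreal K * T t \<le> ennreal K * ennreal (r / (3 * (K + 1)))"
      using elim by (intro mult_left_mono) auto
    also have "\<dots> = ennreal (K * (r / (3 * (K + 1))))"
      using K r by (intro ennreal_mult[symmetric]) auto
    also have "\<dots> \<le> ennreal (r / 3)"
      using K r by (intro ennreal_leI) (simp add: field_simps)
    finally have "sg t E x \<le> ennreal (r / 3) + ennreal (r / 3)"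
      unfolding sE by (intro add_left_mono)
    also have "\<dots> = ennreal (2 * r / 3)" using r by (simp flip: ennreal_plus)
    finally have E: "sg t E x \<le> ennreal (2 * r / 3)" .
    have pw: "ennreal (\<phi> y) \<le> ennreal (\<phi> x) + E y \<and> ennreal (\<phi> x) \<le> ennreal (\<phi> y) + E y" for y
    proof (cases "d \<le> dist x y")
      case True
      then show ?thesis using nn[of x] nn[of y] le[of x] le[of y] K r
        by (auto simp: E_def simp flip: ennreal_plus intro!: ennreal_leI)
    next
      case False
      then have "dist y x < d" by (simp add: dist_commute)
      then have "\<bar>\<phi> y - \<phi> x\<bar> < r / 3" using d(2)[of y] by (simp only: dist_real_def)
      then have "\<phi> y \<le> \<phi> x + r / 3" "\<phi> x \<le> \<phi> y + r / 3" by linarith+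
      then show ?thesis using False nn[of x] nn[of y] r
        by (auto simp: E_def simp flip: ennreal_plus intro!: ennreal_leI)
    qed
    have "sg t (\<lambda>y. ennreal (\<phi> y)) x \<le> sg t (\<lambda>y. ennreal (\<phi> x) + E y) x"
      using pw by (intro sg_mono_AE AE_I2) auto
    also have "\<dots> \<le> ennreal (\<phi> x) + ennreal (2 * r / 3)"
      using E by (simp add: sg_add sg_const elim add_left_mono)
    finally have up: "sg t (\<lambda>y. ennreal (\<phi> y)) x \<le> ennreal (\<phi> x + 2 * r / 3)"
      using r nn by simp
    have "ennreal (\<phi> x) = sg t (\<lambda>y. ennreal (\<phi> x)) x" by (simp add: sg_const elim)
    also have "\<dots> \<le> sg t (\<lambda>y. ennreal (\<phi> y) + E y) x"
      using pw by (intro sg_mono_AE AE_I2) auto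
    also have "\<dots> \<le> sg t (\<lambda>y. ennreal (\<phi> y)) x + ennreal (2 * r / 3)"
      using E by (simp add: sg_add add_left_mono)
    finally have lo: "ennreal (\<phi> x) \<le> sg t (\<lambda>y. ennreal (\<phi> y)) x + ennreal (2 * r / 3)" .
    show ?case
    proof (cases "sg t (\<lambda>y. ennreal (\<phi> y)) x")
      case (real z)
      have "ennreal z \<le> ennreal (\<phi> x + 2 * r / 3)" using up unfolding real(2) .
      then have "z \<le> \<phi> x + 2 * r / 3"
        by (rule ennreal_le_iff[THEN iffD1, rotated]) (use nn[of x] r in simp)
      moreover have "\<phi> x \<le> z + 2 * r / 3"
        using lo real nn[of x] r by (simp flip: ennreal_plus)
      ultimately show ?thesis using real r by (simp add: dist_real_def abs_le_iff abs_less_iff)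
    next
      case top
      then show ?thesis using up by (simp add: top_unique)
    qed
  qed
qed

lemma sg_bounded:
  assumes "\<And>y. g y \<le> c" shows "sg t g x \<le> c"
proof (cases "0 < t")
  case True
  have "sg t g x \<le> sg t (\<lambda>_. c) x" using assms by (intro sg_mono_AE AE_I2)
  then show ?thesis using True by (simp add: sg_const)
qed (simp add: sg_nonpos)

text \<open>Mass conservation turns pointwise convergence into \<open>L\<^sup>1\<close> convergence (Scheffe), and
  boundedness upgrades it to \<open>L\<^sup>p\<close>.\<close>
lemma sg_tendsto_Lp_bounded:
  assumes cont: "continuous_on UNIV \<phi>" and nn: "\<And>y. 0 \<le> \<phi> y" and le: "\<And>y. \<phi> y \<le> K" and K: "0 < K"
    and fin: "(\<integral>\<^sup>+ y. ennreal (\<phi> y) \<partial>lborel) < \<infinity>" and p: "1 \<le> p" and eps: "0 < \<epsilon>"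
  shows "\<forall>\<^sub>F t in at_right 0. Lp_close p (sg t (\<lambda>y. ennreal (\<phi> y))) (\<lambda>y. ennreal (\<phi> y)) (ennreal \<epsilon>)"
\<comment> \<open>Scheffe's lemma speaks of sequences, so the one-sided limit is tested along
  sequences tending to 0 from the right.\<close>
proof (rule sequentially_imp_eventually_within, intro allI impI)
  fix \<tau> :: "nat \<Rightarrow> real"
  assume \<tau>: "(\<forall>n. \<tau> n \<in> {0<..} \<and> \<tau> n \<noteq> 0) \<and> \<tau> \<longlonglongrightarrow> 0"
  then have pos: "0 < \<tau> n" for n by auto
  have lim: "filterlim \<tau> (at_right 0) sequentially"
    using \<tau> by (intro tendsto_imp_filterlim_at_right) auto
  have [measurable]: "\<phi> \<in> borel_measurable borel" by (rule borel_measurable_continuous_onI[OF cont])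
  define F where "F n x = enn2real (sg (\<tau> n) (\<lambda>y. ennreal (\<phi> y)) x)" for n x
  have [measurable]: "F n \<in> borel_measurable borel" for n unfolding F_def by measurable
  have sgK: "sg (\<tau> n) (\<lambda>y. ennreal (\<phi> y)) x \<le> ennreal K" for n x
    by (rule sg_bounded) (simp add: ennreal_leI le)
  have F: "ennreal (F n x) = sg (\<tau> n) (\<lambda>y. ennreal (\<phi> y)) x" for n x
    using le_less_trans[OF sgK ennreal_less_top] by (simp add: F_def)
  have F_nn: "0 \<le> F n x" for n x by (simp add: F_def)
  have F_le: "F n x \<le> K" for n x using sgK[of n x] K unfolding F[symmetric] by simp
  have intF: "(\<integral>\<^sup>+ x. ennreal (F n x) \<partial>lborel) = (\<integral>\<^sup>+ x. ennreal (\<phi> x) \<partial>lborel)" for n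
    unfolding F by (rule nn_integral_sg) (simp_all add: pos)
  have "(\<lambda>n. \<integral>\<^sup>+ x. ennreal (norm (F n x - \<phi> x)) \<partial>lborel) \<longlonglongrightarrow> 0"
  proof (rule Scheffe_lemma1)
    show "integrable lborel (F n)" for n
      by (rule integrableI_nonneg) (use F_nn intF fin in auto)
    show "integrable lborel \<phi>"
      by (rule integrableI_nonneg) (use nn fin in auto)
    show "AE x in lborel. (\<lambda>n. F n x) \<longlonglongrightarrow> \<phi> x"
      unfolding F_def by (intro AE_I2 filterlim_compose[OF sg_tendsto_pointwise[OF cont nn le] lim])
    show "limsup (\<lambda>n. \<integral>\<^sup>+ x. ennreal (norm (F n x)) \<partial>lborel) \<le> (\<integral>\<^sup>+ x. ennreal (norm (\<phi> x)) \<partial>lborel)"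
      using F_nn nn by (simp add: intF Limsup_const)
  qed
  \<comment> \<open>Differences are at most \<open>K\<close>, so their power of order
    \<open>p\<close> costs a factor \<open>K powr (p - 1)\<close>, which the threshold
    anticipates.\<close>
  then have "\<forall>\<^sub>F n in sequentially. (\<integral>\<^sup>+ x. ennreal (norm (F n x - \<phi> x)) \<partial>lborel) < ennreal (\<epsilon> / K powr (p - 1))"
    by (rule order_tendstoD(2)) (use eps K in auto)
  then show "\<forall>\<^sub>F n in sequentially. Lp_close p (sg (\<tau> n) (\<lambda>y. ennreal (\<phi> y))) (\<lambda>y. ennreal (\<phi> y)) (ennreal \<epsilon>)"
  proof eventually_elim
    case (elim n)
    have "(\<integral>\<^sup>+ x. ennreal (\<bar>F n x - \<phi> x\<bar> powr p) \<partial>lborel)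
        \<le> (\<integral>\<^sup>+ x. ennreal (K powr (p - 1)) * ennreal (norm (F n x - \<phi> x)) \<partial>lborel)"
    proof (rule nn_integral_mono)
      fix x
      have D: "\<bar>F n x - \<phi> x\<bar> \<le> K" using F_nn[of n x] F_le[of n x] nn[of x] le[of x] by linarith
      have "\<bar>F n x - \<phi> x\<bar> powr p = \<bar>F n x - \<phi> x\<bar> powr (p - 1) * \<bar>F n x - \<phi> x\<bar>"
        using powr_mult_base[of "\<bar>F n x - \<phi> x\<bar>" "p - 1"] by (simp add: mult.commute)
      also have "\<dots> \<le> K powr (p - 1) * \<bar>F n x - \<phi> x\<bar>"
        using D p by (intro mult_right_mono powr_mono2) auto
      finally show "ennreal (\<bar>F n x - \<phi> x\<bar> powr p) \<le> ennreal (K powr (p - 1)) * ennreal (norm (F n x - \<phi> x))"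
        by (simp flip: ennreal_mult)
    qed
    also have "\<dots> = ennreal (K powr (p - 1)) * (\<integral>\<^sup>+ x. ennreal (norm (F n x - \<phi> x)) \<partial>lborel)"
      by (rule nn_integral_cmult) simp
    also have "\<dots> \<le> ennreal (K powr (p - 1)) * ennreal (\<epsilon> / K powr (p - 1))"
      using elim by (intro mult_left_mono) auto
    also have "\<dots> = ennreal \<epsilon>" using K eps by (simp flip: ennreal_mult)
    finally have "Lp_close p (\<lambda>x. ennreal (F n x)) (\<lambda>x. ennreal (\<phi> x)) (ennreal \<epsilon>)"
      by (intro Lp_close_realI F_nn nn) simp_all
    then show ?case by (simp add: F)
  qed
qed

text \<open>Density argument: \<open>g\<close> is replaced by a bounded continuous function of
  finite integral, and contractivity controls the replacement uniformly in \<open>t\<close>.\<close>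

lemma sg_tendsto_Lp:
  assumes [measurable]: "g \<in> borel_measurable borel" and nn: "\<And>x. 0 \<le> g x" and p: "1 \<le> p"
    and fin: "(\<integral>\<^sup>+ x. ennreal (g x powr p) \<partial>lborel) < \<infinity>" and eps: "0 < \<epsilon>"
  shows "\<forall>\<^sub>F t in at_right 0. Lp_close p (sg t (\<lambda>y. ennreal (g y))) (\<lambda>y. ennreal (g y)) (ennreal \<epsilon>)"
proof -
  obtain \<epsilon>' where eps': "0 < \<epsilon>'"
    and trans3: "\<And>a b c d :: 'a \<Rightarrow> ennreal. \<lbrakk>Lp_close p a b (ennreal \<epsilon>'); Lp_close p b c (ennreal \<epsilon>');
      Lp_close p c d (ennreal \<epsilon>')\<rbrakk> \<Longrightarrow> Lp_close p a d (ennreal \<epsilon>)"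
    by (rule Lp_close_trans3[of p \<epsilon>]) (use p eps in auto)
  obtain \<phi> K where cont: "continuous_on UNIV \<phi>" and \<phi>: "\<And>x. 0 \<le> \<phi> x" "\<And>x. \<phi> x \<le> K" and K: "0 < K"
    and \<phi>fin: "(\<integral>\<^sup>+ x. ennreal (\<phi> x) \<partial>lborel) < \<infinity>"
    and cl: "Lp_close p (\<lambda>x. ennreal (g x)) (\<lambda>x. ennreal (\<phi> x)) (ennreal \<epsilon>')"
    by (rule Lp_approx_continuous[of g p \<epsilon>']) (use assms eps' in auto)
  have [measurable]: "\<phi> \<in> borel_measurable borel" by (rule borel_measurable_continuous_onI[OF cont])
  have "\<forall>\<^sub>F t in at_right 0. Lp_close p (sg t (\<lambda>y. ennreal (\<phi> y))) (\<lambda>y. ennreal (\<phi> y)) (ennreal \<epsilon>')"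
    by (rule sg_tendsto_Lp_bounded[OF cont \<phi> K \<phi>fin p eps'])
  moreover have "\<forall>\<^sub>F t in at_right (0::real). 0 < t" by (rule eventually_at_right_less)
  ultimately show ?thesis
  proof eventually_elim
    case (elim t)
    have "Lp_close p (sg t (\<lambda>x. ennreal (g x))) (sg t (\<lambda>x. ennreal (\<phi> x))) (ennreal \<epsilon>')"
      by (rule Lp_close_sg[OF _ _ elim(2) p cl]) simp_all
    from trans3[OF this elim(1) Lp_close_sym[OF cl]] show ?case .
  qed
qed

end

section \<open>A separable integral equation\<close>

text \<open>Stands in for the chain rule when the density is merely measurable.\<close>
lemma (in finite_borel_measure) distr_cdf_atomless:
  assumes atomless: "\<And>x. measure M {x} = 0" and a: "cdf M a = 0" and at: "a \<le> t"
  shows "distr (density M (indicator {..t})) borel (cdf M) = density lborel (indicator {0..cdf M t})"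
proof (rule measure_eqI_lessThan)
  have cont: "continuous_on S (cdf M)" for S
    using atomless isCont_cdf by (simp add: continuous_at_imp_continuous_on)
  have [measurable]: "cdf M \<in> borel_measurable borel"
    by (rule borel_measurable_continuous_onI[OF cont])
  have mM [simp]: "measurable M N = measurable borel N" for N :: "'c measure"
    by (rule measurable_cong_sets[OF M_is_borel refl])
  have L: "emeasure (distr (density M (indicator {..t})) borel (cdf M)) {x<..} = emeasure M {s. s \<le> t \<and> x < cdf M s}" for x
  proof -
    have "emeasure (distr (density M (indicator {..t})) borel (cdf M)) {x<..}
        = emeasure (density M (indicator {..t})) (cdf M -` {x<..} \<inter> space M)"
      by (subst emeasure_distr) auto
    also have "\<dots> = (\<integral>\<^sup>+ s. indicator {..t} s * indicator (cdf M -` {x<..}) s \<partial>M)"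
      by (subst emeasure_density) (auto simp: borel_UNIV intro!: measurable_sets_borel[of "cdf M" borel])
    also have "\<dots> = (\<integral>\<^sup>+ s. indicator {s. s \<le> t \<and> x < cdf M s} s \<partial>M)"
      by (intro nn_integral_cong) (auto split: split_indicator)
    also have "\<dots> = emeasure M {s. s \<le> t \<and> x < cdf M s}"
    proof (rule nn_integral_indicator)
      have "{s. s \<le> t \<and> x < cdf M s} \<in> sets borel" by measurable
      then show "{s. s \<le> t \<and> x < cdf M s} \<in> sets M" ..
    qed
    finally show ?thesis .
  qed
  have R: "emeasure (density lborel (indicator {0..cdf M t})) {x<..} = emeasure lborel ({0..cdf M t} \<inter> {x<..})" for x
  proof -
    have "emeasure (density lborel (indicator {0..cdf M t})) {x<..}
        = (\<integral>\<^sup>+ y. indicator {0..cdf M t} y * indicator {x<..} y \<partial>lborel)"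
      by (rule emeasure_density) simp_all
    also have "\<dots> = (\<integral>\<^sup>+ y. indicator ({0..cdf M t} \<inter> {x<..}) y \<partial>lborel)"
      by (simp only: indicator_inter_arith)
    also have "\<dots> = emeasure lborel ({0..cdf M t} \<inter> {x<..})"
      by (rule nn_integral_indicator) simp
    finally show ?thesis .
  qed
  show "emeasure (distr (density M (indicator {..t})) borel (cdf M)) {x<..} < \<infinity>" for x
    unfolding L by (simp add: emeasure_eq_measure)
  fix x
  show "emeasure (distr (density M (indicator {..t})) borel (cdf M)) {x<..} =
      emeasure (density lborel (indicator {0..cdf M t})) {x<..}"
  proof -
    consider "x < 0" | "cdf M t \<le> x" "0 \<le> x" | "0 \<le> x" "x < cdf M t" by linarith
    then show ?thesis unfolding L R
    proof cases
      case 1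
      then have "{s. s \<le> t \<and> x < cdf M s} = {..t}" "{0..cdf M t} \<inter> {x<..} = {0..cdf M t}"
        by (auto intro: less_le_trans[OF _ cdf_nonneg])
      then show "emeasure M {s. s \<le> t \<and> x < cdf M s} = emeasure lborel ({0..cdf M t} \<inter> {x<..})"
        using cdf_nonneg[of t] by (simp add: emeasure_eq_measure cdf_def)
    next
      case 2
      then have "{s. s \<le> t \<and> x < cdf M s} = {}" "{0..cdf M t} \<inter> {x<..} = {}"
        using cdf_nondecreasing[of _ t] by (auto simp: not_less dest: order_trans)
      then show "emeasure M {s. s \<le> t \<and> x < cdf M s} = emeasure lborel ({0..cdf M t} \<inter> {x<..})"
        by (simp only: emeasure_empty)
    next
      case 3
      \<comment> \<open>\<open>Z\<close> is a level set, possibly a whole interval on which the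
        distribution function is flat. Its last point \<open>s0\<close> describes the superlevel set
        as \<open>{s0<..t}\<close>.\<close>
      define Z where "Z = {s \<in> {a..t}. cdf M s = x}"
      have "closed Z" unfolding Z_def
        using continuous_closed_preimage_constant[OF cont closed_atLeastAtMost] .
      then have "compact Z" by (intro compact_eq_bounded_closed[THEN iffD2] conjI)
          (auto simp: Z_def intro: bounded_subset[OF bounded_closed_interval[of a t]])
      moreover have "Z \<noteq> {}"
        using IVT'[of "cdf M" a x t, OF _ _ at cont] 3 a by (auto simp: Z_def)
      ultimately obtain s0 where s0: "s0 \<in> Z" "\<And>s. s \<in> Z \<Longrightarrow> s \<le> s0"
        using compact_attains_sup by metis
      have "x < cdf M s \<longleftrightarrow> s0 < s" if "s \<le> t" for s
      proof
        assume "x < cdf M s"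
        then show "s0 < s" using s0(1) cdf_nondecreasing[of s s0] by (force simp: Z_def)
      next
        assume s: "s0 < s"
        have "x \<le> cdf M s" using s0(1) cdf_nondecreasing[of s0 s] s by (auto simp: Z_def)
        moreover have "cdf M s \<noteq> x" using s0(1) s0(2)[of s] s that by (auto simp: Z_def)
        ultimately show "x < cdf M s" by simp
      qed
      then have "{s. s \<le> t \<and> x < cdf M s} = {s0<..t}" by auto
      moreover have "{0..cdf M t} \<inter> {x<..} = {x<..cdf M t}" using 3 by auto
      moreover have "measure M {s0<..t} = cdf M t - x"
        using cdf_diff_eq[of s0 t] s0(1) 3 by (cases "s0 = t") (auto simp: Z_def)
      ultimately show "emeasure M {s. s \<le> t \<and> x < cdf M s} = emeasure lborel ({0..cdf M t} \<inter> {x<..})"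
        using 3 by (simp add: emeasure_eq_measure)
    qed
  qed
qed simp_all

text \<open>The intervals shrink to a single point, a null set, with \<open>h\<close> itself as
  dominating function. This later makes the Duhamel term small on short time intervals.\<close>

lemma nn_integral_tendsto_shrinking_interval:
  fixes h :: "real \<Rightarrow> ennreal"
  assumes [measurable]: "h \<in> borel_measurable borel" and fin: "(\<integral>\<^sup>+ s. h s \<partial>lborel) < \<infinity>"
  shows "(\<lambda>n. \<integral>\<^sup>+ s. h s * indicator {t - 1 / real (Suc n)..t + 1 / real (Suc n)} s \<partial>lborel) \<longlonglongrightarrow> 0"
proof -
  have "(\<lambda>n. \<integral>\<^sup>+ s. h s * indicator {t - 1 / real (Suc n)..t + 1 / real (Suc n)} s \<partial>lborel) \<longlonglongrightarrow> (\<integral>\<^sup>+ s. (0::ennreal) \<partial>(lborel::real measure))"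
  proof (rule nn_integral_dominated_convergence[where w=h])
    show "AE s in lborel. h s * indicator {t - 1 / real (Suc n)..t + 1 / real (Suc n)} s \<le> h s" for n
      by (intro AE_I2) (auto split: split_indicator)
    show "AE s in lborel. (\<lambda>n. h s * indicator {t - 1 / real (Suc n)..t + 1 / real (Suc n)} s) \<longlonglongrightarrow> 0"
      using AE_lborel_singleton[of t]
    proof eventually_elim
      case (elim s)
      have "(\<lambda>n. 1 / real (Suc n)) \<longlonglongrightarrow> 0" using LIMSEQ_inverse_real_of_nat by (simp add: inverse_eq_divide)
      then have "\<forall>\<^sub>F n in sequentially. 1 / real (Suc n) < \<bar>s - t\<bar>"
        by (rule order_tendstoD(2)) (use elim in auto)
      then have "\<forall>\<^sub>F n in sequentially. h s * indicator {t - 1 / real (Suc n)..t + 1 / real (Suc n)} s = 0"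
        by eventually_elim (auto split: split_indicator)
      then show ?case by (rule tendsto_eventually)
    qed
  qed (use fin in auto)
  then show ?thesis by simp
qed

text \<open>\<open>\<beta> = (1 - A(\<alpha> - 1)H)\<^bsup>-1/(\<alpha>-1)\<^esup>\<close> with \<open>H(t) = \<integral>\<^sub>0\<^sup>t h\<close> solves \<open>\<beta>' = A \<beta>\<^sup>\<alpha> h\<close>, \<open>\<beta>(0) = 1\<close>.\<close>
lemma bernoulli_integral_equation:
  fixes h :: "real \<Rightarrow> ennreal" and A \<alpha> :: real
  assumes [measurable]: "h \<in> borel_measurable borel" and h0: "\<And>t. t \<le> 0 \<Longrightarrow> h t = 0"
    and A: "0 < A" and \<alpha>: "1 < \<alpha>"
    and small: "(\<integral>\<^sup>+ s. h s \<partial>lborel) < ennreal (1 / (A * (\<alpha> - 1)))"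
  obtains \<beta> :: "real \<Rightarrow> real" and C where "\<beta> \<in> borel_measurable borel" "\<And>t. 1 \<le> \<beta> t" "\<And>t. \<beta> t \<le> C"
    "\<And>t. 0 \<le> t \<Longrightarrow> 1 + (\<integral>\<^sup>+ s\<in>{0..t}. ennreal (A * \<beta> s powr \<alpha>) * h s \<partial>lborel) = ennreal (\<beta> t)"
proof -
  \<comment> \<open>Turns \<open>h\<close> into a measure with continuous distribution function
    \<open>H\<close>, so that integrals against \<open>h\<close> can be pushed forward under
    \<open>H\<close>.\<close>
  define \<mu> where "\<mu> = density lborel h"
  have em: "emeasure \<mu> S = (\<integral>\<^sup>+ s. h s * indicator S s \<partial>lborel)" if "S \<in> sets borel" for S
    unfolding \<mu>_def using that by (subst emeasure_density) auto
  have emU: "emeasure \<mu> UNIV = (\<integral>\<^sup>+ s. h s \<partial>lborel)" by (simp add: em)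
  have fin: "finite_measure \<mu>"
    by (rule finite_measureI) (use emU less_trans[OF small ennreal_less_top] in \<open>simp add: \<mu>_def\<close>)
  interpret finite_borel_measure \<mu>
    by (intro finite_borel_measure.intro finite_borel_measure_axioms.intro fin) (simp add: \<mu>_def)
  \<comment> \<open>Separating variables gives
    \<open>\<beta> powr (1 - \<alpha>) = 1 - \<kappa> * H\<close>; with \<open>H'\<close> the total
    mass, the smallness hypothesis reads \<open>\<kappa> * H' < 1\<close>.\<close>
  define \<kappa> where "\<kappa> = A * (\<alpha> - 1)"
  have \<kappa>: "0 < \<kappa>" using A \<alpha> by (simp add: \<kappa>_def)
  define H where "H = cdf \<mu>"
  have H0: "H t = 0" if "t \<le> 0" for t
  proof -
    have "emeasure \<mu> {..t} = (\<integral>\<^sup>+ s. 0 \<partial>(lborel :: real measure))"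
      unfolding em[OF borel_closed[OF closed_atMost]]
      by (intro nn_integral_cong) (use that in \<open>auto simp: h0 split: split_indicator\<close>)
    then show ?thesis by (simp add: H_def cdf_def measure_def)
  qed
  have atomless: "measure \<mu> {x} = 0" for x
  proof -
    have "emeasure \<mu> {x} = (\<integral>\<^sup>+ s. 0 \<partial>(lborel :: real measure))"
      unfolding em[OF borel_singleton[OF sets.empty_sets]]
      by (rule nn_integral_cong_AE) (use AE_lborel_singleton[of x] in \<open>auto elim!: eventually_mono\<close>)
    then show ?thesis by (simp add: measure_def)
  qed
  have Hnn: "0 \<le> H t" for t by (simp add: H_def cdf_nonneg)
  define H' where "H' = measure \<mu> UNIV"
  have HH': "H t \<le> H'" for t unfolding H_def cdf_def H'_def by (rule finite_measure_mono) auto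
  have H': "H' < 1 / \<kappa>" "0 \<le> H'"
    using small \<kappa> unfolding emU[symmetric] emeasure_eq_measure H'_def \<kappa>_def by (simp_all add: ennreal_less_iff)
  have cont: "continuous_on UNIV H"
    unfolding H_def using atomless isCont_cdf by (simp add: continuous_at_imp_continuous_on)
  have [measurable]: "H \<in> borel_measurable borel" by (rule borel_measurable_continuous_onI[OF cont])
  define G where "G y = (1 - \<kappa> * y) powr (- 1 / (\<alpha> - 1))" for y :: real
  \<comment> \<open>\<open>g\<close> is both the derivative of \<open>G\<close> and
    \<open>A * G powr \<alpha>\<close>: in the variable \<open>y = H t\<close> the equation is
    autonomous.\<close>
  define g where "g y = A * (1 - \<kappa> * y) powr (- \<alpha> / (\<alpha> - 1))" for y :: real
  have pos: "0 < 1 - \<kappa> * y" if "y \<le> H'" for y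
  proof -
    have "\<kappa> * y \<le> \<kappa> * H'" using that \<kappa> by simp
    also have "\<dots> < 1" using H' \<kappa> by (simp add: field_simps)
    finally show ?thesis by simp
  qed
  have der: "(G has_real_derivative g y) (at y)" if "y \<le> H'" for y
  proof -
    have e: "- 1 / (\<alpha> - 1) - 1 = - \<alpha> / (\<alpha> - 1)" using \<alpha> by (simp add: field_simps)
    have "(G has_real_derivative ((- 1 / (\<alpha> - 1)) * (1 - \<kappa> * y) powr (- 1 / (\<alpha> - 1) - 1) * (0 - \<kappa> * 1))) (at y)"
      unfolding G_def using pos[OF that]
      by (auto intro!: derivative_eq_intros)
    also have "(- 1 / (\<alpha> - 1)) * (1 - \<kappa> * y) powr (- 1 / (\<alpha> - 1) - 1) * (0 - \<kappa> * 1) = g y"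
      using \<alpha> unfolding e by (simp add: g_def \<kappa>_def)
    finally show ?thesis .
  qed
  have Gg: "A * G y powr \<alpha> = g y" if "y \<le> H'" for y
    using pos[OF that] by (simp add: G_def g_def powr_powr)
  have G1: "1 \<le> G y" if "0 \<le> y" "y \<le> H'" for y
  proof -
    have "(1 - \<kappa> * y) powr (1 / (\<alpha> - 1)) \<le> 1"
      using pos[of y] that \<kappa> \<alpha> by (intro powr_le1) auto
    then show ?thesis using pos[of y] that by (simp add: G_def powr_minus_divide minus_divide_left[symmetric])
  qed
  have Gm: "G y \<le> G H'" if "y \<le> H'" for y
    unfolding G_def using that pos[of H'] \<kappa> \<alpha> by (intro powr_mono2') auto
  show ?thesis
  proof (rule that[of "\<lambda>t. G (H t)" "G H'"])
    show "(\<lambda>t. G (H t)) \<in> borel_measurable borel" unfolding G_def by measurable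
    show "1 \<le> G (H t)" "G (H t) \<le> G H'" for t using Hnn HH' by (auto intro: G1 Gm)
    fix t :: real assume t: "0 \<le> t"
    have [measurable]: "g \<in> borel_measurable borel" unfolding g_def by measurable
    \<comment> \<open>As \<open>h\<close> vanishes at nonpositive times, \<open>{0..t}\<close> may
      be replaced by \<open>{..t}\<close>. The pushforward under \<open>H\<close> is then Lebesgue
      measure on \<open>{0..H t}\<close>, where the fundamental theorem of calculus applies to
      \<open>G\<close>.\<close>
    have "(\<integral>\<^sup>+ s\<in>{0..t}. ennreal (A * G (H s) powr \<alpha>) * h s \<partial>lborel)
        = (\<integral>\<^sup>+ s. h s * (ennreal (g (H s)) * indicator {..t} s) \<partial>lborel)"
      by (intro nn_integral_cong) (use h0 in \<open>auto simp: Gg HH' mult.commute split: split_indicator\<close>)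
    also have "\<dots> = (\<integral>\<^sup>+ s. indicator {..t} s * ennreal (g (H s)) \<partial>\<mu>)"
      unfolding \<mu>_def by (subst nn_integral_density) (auto simp: mult.commute)
    also have "\<dots> = (\<integral>\<^sup>+ s. ennreal (g (H s)) \<partial>density \<mu> (indicator {..t}))"
      by (subst nn_integral_density) (auto simp: \<mu>_def)
    also have "\<dots> = (\<integral>\<^sup>+ y. ennreal (g y) \<partial>distr (density \<mu> (indicator {..t})) borel H)"
      by (subst nn_integral_distr) (auto simp: \<mu>_def)
    also have "\<dots> = (\<integral>\<^sup>+ y. ennreal (g y) \<partial>density lborel (indicator {0..H t}))"
      unfolding H_def using distr_cdf_atomless[OF atomless _ t] H0[of 0] by (simp add: H_def)
    also have "\<dots> = (\<integral>\<^sup>+ y. ennreal (g y) * indicator {0..H t} y \<partial>lborel)"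
      by (subst nn_integral_density) (auto simp: mult.commute)
    also have "\<dots> = ennreal (G (H t) - G 0)"
    proof (rule nn_integral_FTC_Icc)
      fix y assume "y \<in> {0..H t}"
      then have y: "y \<le> H'" using HH'[of t] by auto
      show "(G has_real_derivative g y) (at y)" by (rule der[OF y])
      show "0 \<le> g y" using A by (simp add: g_def)
    qed (use Hnn in auto)
    also have "G 0 = 1" by (simp add: G_def)
    finally show "1 + (\<integral>\<^sup>+ s\<in>{0..t}. ennreal (A * G (H s) powr \<alpha>) * h s \<partial>lborel) = ennreal (G (H t))"
      using G1[OF Hnn HH', of t] by (simp flip: ennreal_1 ennreal_plus)
  qed
qed

section \<open>The semilinear equation\<close>

lemma measurable_nn_integral_Icc [measurable (raw)]:
  fixes g :: "'b \<Rightarrow> real \<Rightarrow> ennreal"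
  assumes [measurable]: "(\<lambda>(z, s). g z s) \<in> borel_measurable (M \<Otimes>\<^sub>M borel)"
    "a \<in> borel_measurable M" "b \<in> borel_measurable M"
  shows "(\<lambda>z. \<integral>\<^sup>+ s\<in>{a z..b z}. g z s \<partial>lborel) \<in> borel_measurable M"
proof -
  have *: "indicator {a z..b z} s = (if a z \<le> s \<and> s \<le> b z then 1 else (0::ennreal))" for z s
    by (simp add: indicator_def)
  show ?thesis unfolding * by measurable
qed

locale semilinear_heat = symmetric_heat_kernel P
  for P :: "real \<Rightarrow> 'a::euclidean_space \<Rightarrow> 'a \<Rightarrow> ennreal" +
  fixes f :: "real \<Rightarrow> real" and A \<alpha> \<gamma> :: real and u0 :: "'a \<Rightarrow> real"
  assumes f_cont: "continuous_on {0..} f" and f_mono: "mono_on {0..} f"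
    and f_nonneg: "\<And>u. 0 \<le> u \<Longrightarrow> 0 \<le> f u" and f_le: "\<And>u. 0 \<le> u \<Longrightarrow> f u \<le> A * u powr \<alpha>"
    and A_pos: "0 < A" and \<alpha>: "1 < \<alpha>" and \<gamma>: "1 \<le> \<gamma>"
    and u0_measurable [measurable]: "u0 \<in> borel_measurable borel" and u0_nonneg: "\<And>x. 0 \<le> u0 x"
    and u0_Lp: "(\<integral>\<^sup>+ x. ennreal (u0 x powr \<gamma>) \<partial>lborel) < \<infinity>"
    and small: "(\<integral>\<^sup>+ t\<in>{0<..}. ennpow (esssup lborel (sg t (\<lambda>y. ennreal (u0 y)))) (\<alpha> - 1) \<partial>lborel)
        < ennreal (1 / (A * (\<alpha> - 1)))"
begin

definition v :: "real \<Rightarrow> 'a \<Rightarrow> ennreal" where "v t = sg t (\<lambda>y. ennreal (u0 y))"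

definition h :: "real \<Rightarrow> ennreal" where "h t = ennpow (esssup lborel (v t)) (\<alpha> - 1)"

text \<open>Because \<open>enn2real\<close> sends \<open>top\<close> to 0,
  \<open>F top = F 0\<close>; monotonicity and continuity of \<open>f\<close> are therefore usable
  only at finite values.\<close>

definition F :: "ennreal \<Rightarrow> ennreal" where "F z = ennreal (f (enn2real z))"

text \<open>The starting time is a parameter so that \<open>U_flow\<close> can restart the equation
  at a later time \<open>a\<close>.\<close>

definition duhamel :: "real \<Rightarrow> real \<Rightarrow> (real \<Rightarrow> 'a \<Rightarrow> ennreal) \<Rightarrow> 'a \<Rightarrow> ennreal" where
  "duhamel a t U x = (\<integral>\<^sup>+ \<tau>\<in>{a..t}. sg (t - \<tau>) (\<lambda>y. F (U \<tau> y)) x \<partial>lborel)"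

text \<open>With 0 as first iterate, the base cases of both the upper bound and the monotonicity are
  trivial.\<close>

fun iter :: "nat \<Rightarrow> real \<Rightarrow> 'a \<Rightarrow> ennreal" where
  "iter 0 t x = 0"
| "iter (Suc k) t x = v t x + duhamel 0 t (iter k) x"

definition U :: "real \<Rightarrow> 'a \<Rightarrow> ennreal" where "U t x = (SUP k. iter k t x)"

lemma measurable_v [measurable (raw)]:
  assumes [measurable]: "a \<in> borel_measurable M" "b \<in> borel_measurable M"
  shows "(\<lambda>z. v (a z) (b z)) \<in> borel_measurable M"
  unfolding v_def by measurable

lemma measurable_v' [measurable]: "v t \<in> borel_measurable borel"
  unfolding v_def by measurable

lemma measurable_F [measurable]: "F \<in> borel_measurable borel"
proof -
  have "continuous_on UNIV (\<lambda>z. f (max 0 z))"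
    by (rule continuous_on_compose2[OF f_cont]) (auto intro!: continuous_intros)
  then have [measurable]: "(\<lambda>z. f (max 0 z)) \<in> borel_measurable borel" by (rule borel_measurable_continuous_onI)
  have "F = (\<lambda>z. ennreal (f (max 0 (enn2real z))))" by (simp add: F_def fun_eq_iff max_def)
  also have "\<dots> \<in> borel_measurable borel" by measurable
  finally show ?thesis .
qed

lemma measurable_duhamel:
  assumes [measurable]: "(\<lambda>(t, x). W t x) \<in> borel_measurable (borel \<Otimes>\<^sub>M borel)"
    "a \<in> borel_measurable M" "b \<in> borel_measurable M" "c \<in> borel_measurable M"
  shows "(\<lambda>z. duhamel (a z) (b z) W (c z)) \<in> borel_measurable M"
  unfolding duhamel_def by measurable

lemma measurable_iter [measurable]: "(\<lambda>(t, x). iter k t x) \<in> borel_measurable (borel \<Otimes>\<^sub>M borel)"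
proof (induction k)
  case (Suc k)
  have "(\<lambda>z. duhamel 0 (fst z) (iter k) (snd z)) \<in> borel_measurable (borel \<Otimes>\<^sub>M borel)"
    by (rule measurable_duhamel[OF Suc]) measurable
  then show ?case by (simp add: split_beta')
qed simp

lemma measurable_U [measurable]: "(\<lambda>(t, x). U t x) \<in> borel_measurable (borel \<Otimes>\<^sub>M borel)"
  using measurable_iter unfolding U_def split_beta' by measurable

lemma measurable_U_raw [measurable (raw)]:
  assumes [measurable]: "a \<in> borel_measurable M" "b \<in> borel_measurable M"
  shows "(\<lambda>z. U (a z) (b z)) \<in> borel_measurable M"
proof -
  have "(\<lambda>z. (a z, b z)) \<in> M \<rightarrow>\<^sub>M borel \<Otimes>\<^sub>M borel" by measurable
  from measurable_compose[OF this measurable_U] show ?thesis by simp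
qed

lemma measurable_U_section [measurable]: "U t \<in> borel_measurable borel"
  by (rule measurable_U_raw) simp_all

section \<open>Supremum bounds for the linear evolution and the comparison estimate\<close>

lemma v_nonpos: "t \<le> 0 \<Longrightarrow> v t x = 0"
  by (simp add: v_def sg_nonpos)

lemma sg_v: "0 < s \<Longrightarrow> 0 < t \<Longrightarrow> sg s (v t) x = v (s + t) x"
  unfolding v_def by (rule sg_sg) simp_all

text \<open>\<open>v t\<close> is an average of \<open>v s\<close> against a probability density,
  and averages ignore null sets; so the bound holds at every \<open>x\<close>, not just almost
  everywhere.\<close>

lemma v_le_esssup:
  assumes "0 < s" "s < t"
  shows "v t x \<le> esssup lborel (v s)"
proof -
  have "v t x = sg (t - s) (v s) x" using sg_v[of "t - s" s x] assms by simp
  also have "\<dots> \<le> sg (t - s) (\<lambda>_. esssup lborel (v s)) x"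
    by (rule sg_mono_AE[OF esssup_AE])
  also have "\<dots> = esssup lborel (v s)" using assms by (simp add: sg_const)
  finally show ?thesis .
qed

lemma esssup_v_antimono: "0 < s \<Longrightarrow> s \<le> t \<Longrightarrow> esssup lborel (v t) \<le> esssup lborel (v s)"
  using v_le_esssup[of s t] by (cases "s = t") (auto intro!: esssup_I)

lemma h_nonpos: "t \<le> 0 \<Longrightarrow> h t = 0"
proof -
  assume "t \<le> 0"
  then have "esssup lborel (v t) \<le> 0" by (intro esssup_I) (auto simp: v_nonpos)
  then show ?thesis by (simp add: h_def)
qed

lemma h_antimono: "0 < s \<Longrightarrow> s \<le> t \<Longrightarrow> h t \<le> h s"
  unfolding h_def using \<alpha> by (intro ennpow_mono esssup_v_antimono) auto

lemma small_h: "(\<integral>\<^sup>+ t. h t \<partial>lborel) < ennreal (1 / (A * (\<alpha> - 1)))"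
proof -
  have "(\<integral>\<^sup>+ t. h t \<partial>lborel) = (\<integral>\<^sup>+ t\<in>{0<..}. ennpow (esssup lborel (sg t (\<lambda>y. ennreal (u0 y)))) (\<alpha> - 1) \<partial>lborel)"
  proof (intro nn_integral_cong)
    fix t
    show "h t = ennpow (esssup lborel (sg t (\<lambda>y. ennreal (u0 y)))) (\<alpha> - 1) * indicator {0<..} t"
    proof (cases "0 < t")
      case True
      then show ?thesis by (simp add: h_def v_def)
    next
      case False
      then show ?thesis by (simp add: h_nonpos)
    qed
  qed
  then show ?thesis using small by simp
qed

text \<open>An infinite value would, by \<open>esssup_v_antimono\<close>, occur at all earlier
  positive times as well and make the integral of \<open>h\<close> infinite.\<close>

lemma esssup_v_finite:
  assumes t: "0 < t" shows "esssup lborel (v t) < top"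
proof (rule ccontr)
  assume "\<not> ?thesis"
  then have top: "esssup lborel (v t) = top" using top.not_eq_extremum by blast
  have "h s = top" if "s \<in> {0<..t}" for s
    using esssup_v_antimono[of s t] that top by (simp add: h_def top_unique)
  then have "(\<integral>\<^sup>+ s. top * indicator {0<..t} s \<partial>lborel) \<le> (\<integral>\<^sup>+ s. h s \<partial>lborel)"
    by (intro nn_integral_mono) (auto split: split_indicator)
  moreover have "(\<integral>\<^sup>+ s. top * indicator {0<..t} s \<partial>(lborel::real measure)) = top"
    using t by (subst nn_integral_cmult_indicator) (auto simp: ennreal_top_mult)
  ultimately show False using less_trans[OF small_h ennreal_less_top] by (simp add: top_unique)
qed

lemma v_finite: "v t x < top"
proof (cases "0 < t")
  case True
  then show ?thesis using le_less_trans[OF v_le_esssup[of "t / 2" t x] esssup_v_finite[of "t / 2"]] by simp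
qed (simp add: v_nonpos)

lemma h_finite: "h t < top"
  using esssup_v_finite[of t] h_nonpos[of t] unfolding h_def by (cases "0 < t") (auto intro: ennpow_less_top)

text \<open>Measurability in time of an essential supremum comes from monotonicity on each
  half-line; the minus sign turns decreasing pieces into increasing ones.\<close>

lemma measurable_h [measurable]: "h \<in> borel_measurable borel"
proof -
  have "(\<lambda>t. - enn2real (h t)) \<in> borel_measurable borel"
  proof (rule borel_measurable_piecewise_mono[where C="{{..0}, {0<..}}"])
    fix c :: "real set" assume "c \<in> {{..0}, {0<..}}"
    then consider "c = {..0}" | "c = {0<..}" by blast
    then show "mono_on c (\<lambda>t. - enn2real (h t))"
    proof cases
      case 1
      then show ?thesis by (intro mono_onI) (simp add: h_nonpos)
    next
      case 2
      then show ?thesis by (intro mono_onI) (simp add: enn2real_mono h_antimono h_finite)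
    qed
  qed auto
  then have "(\<lambda>t. ennreal (- (- enn2real (h t)))) \<in> borel_measurable borel" by measurable
  then show ?thesis using h_finite by simp
qed

text \<open>Split \<open>(b * v) powr \<alpha>\<close> into \<open>b powr \<alpha>\<close>, a factor
  \<open>v powr (\<alpha> - 1)\<close> bounded by \<open>h t\<close>, and one spare factor
  \<open>v\<close>. At \<open>t \<le> 0\<close> both sides vanish, because the power bound forces
  \<open>f 0 = 0\<close>.\<close>

lemma F_v_le:
  assumes z: "z \<le> ennreal b * v t y" and b: "0 \<le> b" and v: "v t y \<le> esssup lborel (v t)"
  shows "F z \<le> ennreal (A * b powr \<alpha>) * h t * v t y"
proof (cases "0 < t")
  case True
  define r where "r = enn2real (v t y)"
  have r: "v t y = ennreal r" "0 \<le> r" using v_finite by (auto simp: r_def)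
  define m where "m = enn2real (esssup lborel (v t))"
  have m: "esssup lborel (v t) = ennreal m" "0 \<le> m" using esssup_v_finite[OF True] by (auto simp: m_def)
  have rm: "r \<le> m" using v m unfolding r by simp
  have z': "z \<le> ennreal (b * r)" using z b r by (simp add: ennreal_mult)
  then have e: "enn2real z \<le> b * r" using b r by (metis enn2real_leI mult_nonneg_nonneg)
  have "f (enn2real z) \<le> f (b * r)"
    using e b r by (intro mono_onD[OF f_mono]) auto
  also have "\<dots> \<le> A * (b * r) powr \<alpha>" using b r by (intro f_le) auto
  also have "\<dots> = A * b powr \<alpha> * (r powr (\<alpha> - 1) * r)"
    using b r powr_mult_base[of r "\<alpha> - 1"] by (simp add: powr_mult mult.commute)
  also have "\<dots> \<le> A * b powr \<alpha> * (m powr (\<alpha> - 1) * r)"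
    using rm r \<alpha> A_pos by (intro mult_left_mono mult_right_mono powr_mono2) auto
  finally have "F z \<le> ennreal (A * b powr \<alpha> * (m powr (\<alpha> - 1) * r))"
    unfolding F_def by (rule ennreal_leI)
  also have "\<dots> = ennreal (A * b powr \<alpha>) * h t * v t y"
    using A_pos r m by (simp add: h_def ennreal_mult mult.assoc)
  finally show ?thesis .
next
  case False
  then have "z = 0" using z by (simp add: v_nonpos)
  moreover have "f 0 = 0" using f_le[of 0] f_nonneg[of 0] by simp
  ultimately show ?thesis by (simp add: F_def)
qed

text \<open>The semigroup law carries the spare factor \<open>v \<tau>\<close> to
  \<open>v t\<close>. That \<open>v \<tau>\<close> stays below its essential supremum only almost
  everywhere does not matter inside the integral.\<close>

lemma sg_F_le:
  assumes W: "\<And>y. W y \<le> ennreal b * v \<tau> y" and b: "0 \<le> b" and \<tau>: "\<tau> \<le> t"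
  shows "sg (t - \<tau>) (\<lambda>y. F (W y)) x \<le> ennreal (A * b powr \<alpha>) * h \<tau> * v t x"
proof (cases "0 < \<tau> \<and> \<tau> < t")
  case True
  have "AE y in lborel. v \<tau> y \<le> esssup lborel (v \<tau>)" by (rule esssup_AE)
  then have "AE y in lborel. F (W y) \<le> ennreal (A * b powr \<alpha>) * h \<tau> * v \<tau> y"
    by (auto elim!: eventually_mono intro: F_v_le[OF W b])
  then have "sg (t - \<tau>) (\<lambda>y. F (W y)) x \<le> sg (t - \<tau>) (\<lambda>y. ennreal (A * b powr \<alpha>) * h \<tau> * v \<tau> y) x"
    by (rule sg_mono_AE)
  also have "\<dots> = ennreal (A * b powr \<alpha>) * h \<tau> * v t x"
    using True sg_v[of "t - \<tau>" \<tau> x] by (simp add: sg_cmult)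
  finally show ?thesis .
next
  case False
  then consider "\<tau> \<le> 0" | "t - \<tau> \<le> 0" by linarith
  then show ?thesis
  proof cases
    case 1
    then have "F (W y) \<le> 0" for y
      using F_v_le[OF W b, of y] by (simp add: v_nonpos)
    then show ?thesis by (simp add: sg_def)
  qed (simp add: sg_nonpos)
qed

lemma duhamel_le:
  assumes W: "\<And>\<tau> y. W \<tau> y \<le> ennreal (b \<tau>) * v \<tau> y" and b: "\<And>\<tau>. 0 \<le> b \<tau>"
    and [measurable]: "b \<in> borel_measurable borel"
  shows "duhamel a t W x \<le> (\<integral>\<^sup>+ \<tau>\<in>{a..t}. ennreal (A * b \<tau> powr \<alpha>) * h \<tau> \<partial>lborel) * v t x"
proof -
  have "duhamel a t W x \<le> (\<integral>\<^sup>+ \<tau>. ennreal (A * b \<tau> powr \<alpha>) * h \<tau> * indicator {a..t} \<tau> * v t x \<partial>lborel)"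
    unfolding duhamel_def
    by (intro nn_integral_mono) (auto split: split_indicator intro!: sg_F_le W b)
  also have "\<dots> = (\<integral>\<^sup>+ \<tau>\<in>{a..t}. ennreal (A * b \<tau> powr \<alpha>) * h \<tau> \<partial>lborel) * v t x"
    by (rule nn_integral_multc) simp
  finally show ?thesis .
qed

text \<open>The integral equation for \<open>\<beta>\<close>, multiplied by \<open>v t x\<close>, is
  exactly the induction step: inserting the bound for one iterate reproduces it for the
  next.\<close>

lemma iter_bounds:
  obtains \<beta> C where "\<beta> \<in> borel_measurable borel" "\<And>t. 1 \<le> \<beta> t" "\<And>t. \<beta> t \<le> (C::real)"
    "\<And>k t x. iter k t x \<le> ennreal (\<beta> t) * v t x"
proof -
  obtain \<beta> C where [measurable]: "\<beta> \<in> borel_measurable borel" and \<beta>: "\<And>t. 1 \<le> \<beta> t" "\<And>t. \<beta> t \<le> (C::real)"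
    and eq: "\<And>t. 0 \<le> t \<Longrightarrow> 1 + (\<integral>\<^sup>+ s\<in>{0..t}. ennreal (A * \<beta> s powr \<alpha>) * h s \<partial>lborel) = ennreal (\<beta> t)"
    by (rule bernoulli_integral_equation[OF measurable_h h_nonpos A_pos \<alpha> small_h]) (assumption, rule that)
  have \<beta>0: "0 \<le> \<beta> t" for t using \<beta>(1)[of t] by simp
  have "iter k t x \<le> ennreal (\<beta> t) * v t x" for k t x
  proof (induction k arbitrary: t x)
    case (Suc k)
    have D: "duhamel 0 t (iter k) x \<le> (\<integral>\<^sup>+ \<tau>\<in>{0..t}. ennreal (A * \<beta> \<tau> powr \<alpha>) * h \<tau> \<partial>lborel) * v t x"
      by (rule duhamel_le) (use Suc \<beta>0 in auto)
    show ?case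
    proof (cases "0 \<le> t")
      case True
      have "iter (Suc k) t x \<le> 1 * v t x + (\<integral>\<^sup>+ \<tau>\<in>{0..t}. ennreal (A * \<beta> \<tau> powr \<alpha>) * h \<tau> \<partial>lborel) * v t x"
        using D by (simp add: add_left_mono)
      also have "\<dots> = ennreal (\<beta> t) * v t x"
        unfolding eq[OF True, symmetric] by (simp only: distrib_right)
      finally show ?thesis .
    next
      case False
      then show ?thesis by (simp add: duhamel_def v_nonpos)
    qed
  qed simp
  note le = this
  show ?thesis by (rule that[of \<beta> C]) (use \<beta> le in auto)
qed

lemma iter_finite: "iter k t x < top"
proof -
  obtain \<beta> C where "\<And>k t x. iter k t x \<le> ennreal (\<beta> t) * v t x"
    by (rule iter_bounds) (rule that)
  then show ?thesis using le_less_trans ennreal_mult_less_top v_finite ennreal_less_top by metis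
qed

section \<open>Monotone limit of the iterates\<close>

lemma F_mono: "y \<le> z \<Longrightarrow> z < top \<Longrightarrow> F y \<le> F z"
  unfolding F_def by (intro ennreal_leI mono_onD[OF f_mono] enn2real_mono) auto

lemma sg_mono: "(\<And>y. g y \<le> g' y) \<Longrightarrow> sg t g x \<le> sg t g' x"
  by (rule sg_mono_AE) simp

lemma iter_le_Suc: "iter k t x \<le> iter (Suc k) t x"
proof (induction k arbitrary: t x)
  case (Suc k)
  have "duhamel 0 t (iter k) x \<le> duhamel 0 t (iter (Suc k)) x"
    unfolding duhamel_def
    by (intro nn_integral_mono mult_right_mono sg_mono F_mono Suc iter_finite) auto
  then show ?case by (simp add: add_left_mono)
qed simp

lemma incseq_iter: "incseq (\<lambda>k. iter k t x)"
  by (intro incseq_SucI iter_le_Suc)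

lemma U_bounds:
  obtains C where "1 < (C::real)" "\<And>t x. U t x \<le> ennreal C * v t x"
proof -
  obtain \<beta> C where \<beta>: "\<And>t. 1 \<le> \<beta> t" "\<And>t. \<beta> t \<le> (C::real)" and le: "\<And>k t x. iter k t x \<le> ennreal (\<beta> t) * v t x"
    by (rule iter_bounds) (rule that)
  \<comment> \<open>The constant from \<open>iter_bounds\<close> is only known to be at least 1; the
    maximum with 2 makes the inequality strict.\<close>
  have "U t x \<le> ennreal (max C 2) * v t x" for t x
    unfolding U_def
  proof (rule SUP_least)
    fix k
    have "ennreal (\<beta> t) * v t x \<le> ennreal (max C 2) * v t x"
      using \<beta>(2)[of t] by (intro mult_right_mono ennreal_leI) auto
    then show "iter k t x \<le> ennreal (max C 2) * v t x" using le order_trans by blast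
  qed
  then show ?thesis by (intro that[of "max C 2"]) auto
qed

lemma U_finite: "U t x < top"
proof -
  obtain C where "\<And>t x. U t x \<le> ennreal C * v t x"
    by (rule U_bounds) (rule that)
  then show ?thesis using le_less_trans ennreal_mult_less_top v_finite ennreal_less_top by metis
qed

text \<open>Continuity of \<open>f\<close> at the finite value \<open>U t x\<close>. Finiteness is
  essential, as \<open>enn2real\<close> is discontinuous at \<open>top\<close>.\<close>

lemma F_U: "F (U t x) = (SUP k. F (iter k t x))"
proof (rule LIMSEQ_unique)
  have inc: "incseq (\<lambda>k. F (iter k t x))"
    by (intro incseq_SucI F_mono iter_le_Suc iter_finite)
  then show "(\<lambda>k. F (iter k t x)) \<longlonglongrightarrow> (SUP k. F (iter k t x))" by (rule LIMSEQ_SUP)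
  have "(\<lambda>k. iter k t x) \<longlonglongrightarrow> U t x" unfolding U_def by (rule LIMSEQ_SUP[OF incseq_iter])
  then have "(\<lambda>k. iter k t x) \<longlonglongrightarrow> ennreal (enn2real (U t x))" using U_finite by simp
  then have lim: "(\<lambda>k. enn2real (iter k t x)) \<longlonglongrightarrow> enn2real (U t x)" by (rule tendsto_enn2real) simp
  have "(\<lambda>k. f (enn2real (iter k t x))) \<longlonglongrightarrow> f (enn2real (U t x))"
    by (rule continuous_on_tendsto_compose[OF f_cont lim]) auto
  then show "(\<lambda>k. F (iter k t x)) \<longlonglongrightarrow> F (U t x)" unfolding F_def by (rule tendsto_ennrealI)
qed

text \<open>Monotone convergence twice, in space under \<open>sg\<close> and then in time, lets the
  recursion pass to the limit.\<close>

lemma U_eq: "U t x = v t x + duhamel 0 t U x"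
proof -
  have 1: "sg s (\<lambda>y. F (U \<tau> y)) x = (SUP k. sg s (\<lambda>y. F (iter k \<tau> y)) x)" for s \<tau>
  proof -
    have [measurable]: "(\<lambda>y. F (iter k \<tau> y)) \<in> borel_measurable borel" for k by measurable
    have "sg s (\<lambda>y. F (U \<tau> y)) x = (\<integral>\<^sup>+ y. (SUP k. P s x y * F (iter k \<tau> y)) \<partial>lborel)"
      unfolding sg_def F_U by (simp add: SUP_mult_left_ennreal)
    also have "\<dots> = (SUP k. sg s (\<lambda>y. F (iter k \<tau> y)) x)"
      unfolding sg_def
    proof (rule nn_integral_monotone_convergence_SUP)
      show "incseq (\<lambda>k y. P s x y * F (iter k \<tau> y))"
        by (intro incseq_SucI le_funI mult_left_mono F_mono iter_le_Suc iter_finite) simp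
    qed simp
    finally show ?thesis .
  qed
  have "duhamel 0 t U x = (\<integral>\<^sup>+ \<tau>. (SUP k. sg (t - \<tau>) (\<lambda>y. F (iter k \<tau> y)) x * indicator {0..t} \<tau>) \<partial>lborel)"
    unfolding duhamel_def 1 by (simp add: SUP_mult_right_ennreal)
  also have "\<dots> = (SUP k. duhamel 0 t (iter k) x)"
    unfolding duhamel_def
  proof (rule nn_integral_monotone_convergence_SUP)
    show "incseq (\<lambda>k \<tau>. sg (t - \<tau>) (\<lambda>y. F (iter k \<tau> y)) x * indicator {0..t} \<tau>)"
      by (intro incseq_SucI le_funI mult_right_mono sg_mono F_mono iter_le_Suc iter_finite) simp
    show "(\<lambda>\<tau>. sg (t - \<tau>) (\<lambda>y. F (iter k \<tau> y)) x * indicator {0..t} \<tau>) \<in> borel_measurable lborel" for k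
      by measurable
  qed
  finally have D: "duhamel 0 t U x = (SUP k. duhamel 0 t (iter k) x)" .
  have "(\<lambda>k. iter (Suc k) t x) \<longlonglongrightarrow> U t x"
    unfolding U_def by (rule LIMSEQ_Suc[OF LIMSEQ_SUP[OF incseq_iter]])
  moreover have "(\<lambda>k. iter (Suc k) t x) \<longlonglongrightarrow> (SUP k. iter (Suc k) t x)"
    by (intro LIMSEQ_SUP incseq_SucI iter_le_Suc)
  ultimately have "U t x = (SUP k. iter (Suc k) t x)" by (rule LIMSEQ_unique)
  also have "\<dots> = v t x + duhamel 0 t U x"
    unfolding D by (simp add: ennreal_SUP_add_right)
  finally show ?thesis .
qed

text \<open>The kernel is zero at time 0, hence so is \<open>U 0\<close>; the initial value has to
  be put back by hand.\<close>

definition W :: "real \<Rightarrow> 'a \<Rightarrow> ennreal" where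
  "W t x = (if t = 0 then ennreal (u0 x) else U t x)"

lemma W_0: "W 0 = (\<lambda>x. ennreal (u0 x))" and W_U: "t \<noteq> 0 \<Longrightarrow> W t = U t"
  by (auto simp: W_def)

lemma measurable_W [measurable]: "W t \<in> borel_measurable borel"
  by (cases "t = 0") (simp_all add: W_0 W_U)

lemma W_finite: "W t x < top"
  by (simp add: W_def U_finite)

lemma measurable_duhamel_U [measurable]: "duhamel a t U \<in> borel_measurable borel"
  by (rule measurable_duhamel[OF measurable_U]) simp_all

text \<open>Split the Duhamel integral at \<open>a\<close>; by Tonelli and the semigroup law, the
  part over \<open>{0..a}\<close> is \<open>sg (s - a)\<close> applied to the Duhamel term at time
  \<open>a\<close>.\<close>

lemma U_flow:
  assumes "0 \<le> a" "a < s"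
  shows "U s x = sg (s - a) (W a) x + duhamel a s U x"
proof (cases "a = 0")
  case True
  then show ?thesis using U_eq[of s x] by (simp add: W_0 v_def)
next
  case False
  then have a: "0 < a" using assms by simp
  define g where "g \<tau> = (\<lambda>y. F (U \<tau> y))" for \<tau>
  have [measurable]: "g \<tau> \<in> borel_measurable borel" for \<tau> unfolding g_def by measurable
  have "sg (s - a) (duhamel 0 a U) x
      = (\<integral>\<^sup>+ y. (\<integral>\<^sup>+ \<tau>. P (s - a) x y * (sg (a - \<tau>) (\<lambda>y. F (U \<tau> y)) y * indicator {0..a} \<tau>) \<partial>lborel) \<partial>lborel)"
    unfolding sg_def[of "s - a"] duhamel_def by (subst nn_integral_cmult) simp_all
  also have "\<dots> = (\<integral>\<^sup>+ \<tau>. (\<integral>\<^sup>+ y. P (s - a) x y * (sg (a - \<tau>) (\<lambda>y. F (U \<tau> y)) y * indicator {0..a} \<tau>) \<partial>lborel) \<partial>lborel)"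
    by (rule lborel_pair.Fubini') measurable
  also have "\<dots> = (\<integral>\<^sup>+ \<tau>. sg (s - a) (sg (a - \<tau>) (g \<tau>)) x * indicator {0..a} \<tau> \<partial>lborel)"
    unfolding g_def[symmetric] sg_def[of "s - a"]
    by (simp add: nn_integral_multc flip: mult.assoc)
  also have "\<dots> = (\<integral>\<^sup>+ \<tau>. sg (s - \<tau>) (g \<tau>) x * indicator {0..a} \<tau> \<partial>lborel)"
  proof (rule nn_integral_cong_AE)
    \<comment> \<open>The time \<open>\<tau> = a\<close> is left out because \<open>sg 0\<close> is
      zero rather than the identity.\<close>
    show "AE \<tau> in lborel. sg (s - a) (sg (a - \<tau>) (g \<tau>)) x * indicator {0..a} \<tau> = sg (s - \<tau>) (g \<tau>) x * indicator {0..a} \<tau>"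
      using AE_lborel_singleton[of a]
    proof eventually_elim
      case (elim \<tau>)
      show ?case using elim assms by (cases "\<tau> < a") (simp_all add: sg_sg)
    qed
  qed
  finally have 1: "sg (s - a) (duhamel 0 a U) x = (\<integral>\<^sup>+ \<tau>. sg (s - \<tau>) (g \<tau>) x * indicator {0..a} \<tau> \<partial>lborel)" .
  have "duhamel 0 s U x = (\<integral>\<^sup>+ \<tau>. sg (s - \<tau>) (g \<tau>) x * indicator {0..a} \<tau> + sg (s - \<tau>) (g \<tau>) x * indicator {a..s} \<tau> \<partial>lborel)"
    unfolding duhamel_def g_def
  proof (rule nn_integral_cong_AE)
    \<comment> \<open>The two closed intervals overlap only in the null set
      \<open>{a}\<close>.\<close>
    show "AE \<tau> in lborel. sg (s - \<tau>) (\<lambda>y. F (U \<tau> y)) x * indicator {0..s} \<tau> =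
        sg (s - \<tau>) (\<lambda>y. F (U \<tau> y)) x * indicator {0..a} \<tau> + sg (s - \<tau>) (\<lambda>y. F (U \<tau> y)) x * indicator {a..s} \<tau>"
      using AE_lborel_singleton[of a]
      by eventually_elim (use assms in \<open>auto split: split_indicator\<close>)
  qed
  also have "\<dots> = sg (s - a) (duhamel 0 a U) x + duhamel a s U x"
    unfolding 1 duhamel_def unfolding g_def by (rule nn_integral_add) measurable
  finally have 2: "duhamel 0 s U x = sg (s - a) (duhamel 0 a U) x + duhamel a s U x" .
  have "sg (s - a) (U a) x = sg (s - a) (\<lambda>y. v a y + duhamel 0 a U y) x"
    by (subst U_eq[abs_def]) simp
  also have "\<dots> = v s x + sg (s - a) (duhamel 0 a U) x"
    using sg_v[of "s - a" a x] a assms by (simp add: sg_add)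
  finally show ?thesis
    using U_eq[of s x] 2 False by (simp add: W_U add.assoc)
qed

section \<open>Bounds and continuity in time for the Lebesgue norm of exponent \<gamma>\<close>

lemma v_Lp: "(\<integral>\<^sup>+ x. ennpow (v t x) \<gamma> \<partial>lborel) \<le> (\<integral>\<^sup>+ x. ennreal (u0 x powr \<gamma>) \<partial>lborel)"
proof (cases "0 < t")
  case True
  have "(\<integral>\<^sup>+ x. ennpow (v t x) \<gamma> \<partial>lborel) \<le> (\<integral>\<^sup>+ x. sg t (\<lambda>y. ennpow (ennreal (u0 y)) \<gamma>) x \<partial>lborel)"
    unfolding v_def by (intro nn_integral_mono sg_jensen True \<gamma>) simp
  also have "\<dots> = (\<integral>\<^sup>+ x. ennreal (u0 x powr \<gamma>) \<partial>lborel)"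
    using True by (simp add: nn_integral_sg u0_nonneg)
  finally show ?thesis .
qed (simp add: v_nonpos)

lemma W_Lp: "(\<integral>\<^sup>+ x. ennpow (W t x) \<gamma> \<partial>lborel) < \<infinity>"
proof (cases "t = 0")
  case True
  then show ?thesis using u0_Lp by (simp add: W_0 u0_nonneg)
next
  case False
  obtain C where C: "1 < (C::real)" "\<And>t x. U t x \<le> ennreal C * v t x"
    by (rule U_bounds) (rule that)
  have "(\<integral>\<^sup>+ x. ennpow (W t x) \<gamma> \<partial>lborel) \<le> (\<integral>\<^sup>+ x. ennreal (C powr \<gamma>) * ennpow (v t x) \<gamma> \<partial>lborel)"
  proof (rule nn_integral_mono)
    fix x
    have "ennpow (U t x) \<gamma> \<le> ennpow (ennreal C * v t x) \<gamma>" using C \<gamma> by (intro ennpow_mono) auto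
    then show "ennpow (W t x) \<gamma> \<le> ennreal (C powr \<gamma>) * ennpow (v t x) \<gamma>"
      using C False by (simp add: W_U ennpow_mult)
  qed
  also have "\<dots> = ennreal (C powr \<gamma>) * (\<integral>\<^sup>+ x. ennpow (v t x) \<gamma> \<partial>lborel)"
    by (rule nn_integral_cmult) simp
  also have "\<dots> < \<infinity>"
    using le_less_trans[OF v_Lp u0_Lp] by (simp add: ennreal_mult_less_top)
  finally show ?thesis .
qed

text \<open>The Duhamel term is at most a constant times the integral of \<open>h\<close> over
  \<open>{a..s}\<close> times \<open>v s\<close>, and \<open>v s\<close> is bounded in norm
  uniformly in \<open>s\<close>. Hence one \<open>r\<close> serves all \<open>a\<close> and
  \<open>s\<close>.\<close>

lemma duhamel_Lp_small:
  assumes \<delta>: "0 < \<delta>"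
  obtains r where "0 < r"
    "\<And>a s. t - r \<le> a \<Longrightarrow> s \<le> t + r \<Longrightarrow> (\<integral>\<^sup>+ x. ennpow (duhamel a s U x) \<gamma> \<partial>lborel) \<le> ennreal \<delta>"
proof -
  obtain C where C: "1 < (C::real)" "\<And>t x. U t x \<le> ennreal C * v t x"
    by (rule U_bounds) (rule that)
  define K where "K = A * C powr \<alpha>"
  have K: "0 < K" using C A_pos by (simp add: K_def)
  define N where "N = enn2real (\<integral>\<^sup>+ x. ennreal (u0 x powr \<gamma>) \<partial>lborel)"
  have N: "0 \<le> N" "(\<integral>\<^sup>+ x. ennreal (u0 x powr \<gamma>) \<partial>lborel) = ennreal N" using u0_Lp by (simp_all add: N_def)
  \<comment> \<open>Chosen so that \<open>m powr \<gamma> * N \<le> \<delta>\<close>;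
    \<open>N + 1\<close> guards against \<open>N = 0\<close>.\<close>
  define m where "m = (\<delta> / (N + 1)) powr (1 / \<gamma>)"
  have m: "0 < m" "m powr \<gamma> = \<delta> / (N + 1)" using \<delta> N \<gamma> by (simp_all add: m_def powr_powr)
  have "(\<lambda>n. \<integral>\<^sup>+ s. h s * indicator {t - 1 / real (Suc n)..t + 1 / real (Suc n)} s \<partial>lborel) \<longlonglongrightarrow> 0"
    by (rule nn_integral_tendsto_shrinking_interval) (use less_trans[OF small_h ennreal_less_top] in auto)
  then have "\<forall>\<^sub>F n in sequentially. (\<integral>\<^sup>+ s. h s * indicator {t - 1 / real (Suc n)..t + 1 / real (Suc n)} s \<partial>lborel) < ennreal (m / K)"
    by (rule order_tendstoD(2)) (use m K in auto)
  then obtain n where n: "(\<integral>\<^sup>+ s. h s * indicator {t - 1 / real (Suc n)..t + 1 / real (Suc n)} s \<partial>lborel) < ennreal (m / K)"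
    using eventually_sequentially by auto
  show ?thesis
  proof (rule that[of "1 / real (Suc n)"])
    fix a s assume as: "t - 1 / real (Suc n) \<le> a" "s \<le> t + 1 / real (Suc n)"
    have D: "duhamel a s U x \<le> ennreal m * v s x" for x
    proof -
      have "duhamel a s U x \<le> (\<integral>\<^sup>+ \<tau>\<in>{a..s}. ennreal (A * C powr \<alpha>) * h \<tau> \<partial>lborel) * v s x"
        by (rule duhamel_le) (use C in auto)
      also have "(\<integral>\<^sup>+ \<tau>\<in>{a..s}. ennreal (A * C powr \<alpha>) * h \<tau> \<partial>lborel) = ennreal K * (\<integral>\<^sup>+ \<tau>. h \<tau> * indicator {a..s} \<tau> \<partial>lborel)"
        unfolding K_def[symmetric] mult.assoc by (rule nn_integral_cmult) simp
      also have "\<dots> * v s x \<le> (ennreal K * ennreal (m / K)) * v s x"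
      proof (intro mult_right_mono mult_left_mono)
        have "(\<integral>\<^sup>+ \<tau>. h \<tau> * indicator {a..s} \<tau> \<partial>lborel) \<le> (\<integral>\<^sup>+ s. h s * indicator {t - 1 / real (Suc n)..t + 1 / real (Suc n)} s \<partial>lborel)"
          using as by (intro nn_integral_mono) (auto split: split_indicator)
        then show "(\<integral>\<^sup>+ \<tau>. h \<tau> * indicator {a..s} \<tau> \<partial>lborel) \<le> ennreal (m / K)" using n by simp
      qed auto
      also have "ennreal K * ennreal (m / K) = ennreal m" using K m by (simp flip: ennreal_mult)
      finally show ?thesis .
    qed
    have "(\<integral>\<^sup>+ x. ennpow (duhamel a s U x) \<gamma> \<partial>lborel) \<le> (\<integral>\<^sup>+ x. ennreal (m powr \<gamma>) * ennpow (v s x) \<gamma> \<partial>lborel)"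
    proof (rule nn_integral_mono)
      fix x
      have "ennpow (duhamel a s U x) \<gamma> \<le> ennpow (ennreal m * v s x) \<gamma>" using D \<gamma> by (intro ennpow_mono) auto
      then show "ennpow (duhamel a s U x) \<gamma> \<le> ennreal (m powr \<gamma>) * ennpow (v s x) \<gamma>"
        using m by (simp add: ennpow_mult)
    qed
    also have "\<dots> = ennreal (m powr \<gamma>) * (\<integral>\<^sup>+ x. ennpow (v s x) \<gamma> \<partial>lborel)"
      by (rule nn_integral_cmult) simp
    also have "\<dots> \<le> ennreal (\<delta> / (N + 1)) * ennreal N"
      unfolding m(2) N(2)[symmetric] by (intro mult_left_mono v_Lp) simp
    also have "\<dots> = ennreal (\<delta> / (N + 1) * N)" using \<delta> N by (intro ennreal_mult[symmetric]) auto
    also have "\<dots> \<le> ennreal \<delta>" using \<delta> N by (intro ennreal_leI) (simp add: field_simps)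
    finally show "(\<integral>\<^sup>+ x. ennpow (duhamel a s U x) \<gamma> \<partial>lborel) \<le> ennreal \<delta>" .
  qed simp
qed

text \<open>Both \<open>W s\<close> and \<open>W t\<close> are compared with the linear evolution of
  one earlier state \<open>W a\<close>. This treats left and right limits alike and uses strong
  continuity of the semigroup only at the fixed function \<open>W a\<close>.\<close>

lemma W_continuous:
  assumes t: "0 \<le> t" and \<epsilon>: "0 < \<epsilon>"
  shows "\<forall>\<^sub>F s in at t within {0..}. Lp_close \<gamma> (W s) (W t) (ennreal \<epsilon>)"
proof -
  obtain \<delta> where \<delta>: "0 < \<delta>"
    and trans3: "\<And>a b c d :: 'a \<Rightarrow> ennreal. \<lbrakk>Lp_close \<gamma> a b (ennreal \<delta>); Lp_close \<gamma> b c (ennreal \<delta>);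
      Lp_close \<gamma> c d (ennreal \<delta>)\<rbrakk> \<Longrightarrow> Lp_close \<gamma> a d (ennreal \<epsilon>)"
    by (rule Lp_close_trans3[of \<gamma> \<epsilon>]) (use \<gamma> \<epsilon> in auto)
  obtain r where r: "0 < r"
    and small: "\<And>a s. t - r \<le> a \<Longrightarrow> s \<le> t + r \<Longrightarrow> (\<integral>\<^sup>+ x. ennpow (duhamel a s U x) \<gamma> \<partial>lborel) \<le> ennreal \<delta>"
    by (rule duhamel_Lp_small[OF \<delta>, of t]) (rule that)
  define a where "a = max 0 (t - r)"
  have a: "0 \<le> a" "t - r \<le> a" "a \<le> t" using t r by (auto simp: a_def)
  have flow: "Lp_close \<gamma> (W s) (sg (s - a) (W a)) (ennreal \<delta>)" if s: "a < s" "s \<le> t + r" for s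
  proof (rule Lp_closeI[of "duhamel a s U"])
    show "AE x in lborel. W s x \<le> sg (s - a) (W a) x + duhamel a s U x \<and> sg (s - a) (W a) x \<le> W s x + duhamel a s U x"
      using U_flow[OF a(1) s(1)] a s by (intro AE_I2) (simp add: W_U add.assoc)
    show "(\<integral>\<^sup>+ x. ennpow (duhamel a s U x) \<gamma> \<partial>lborel) \<le> ennreal \<delta>" by (rule small[OF a(2) s(2)])
  qed simp
  define w where "w x = enn2real (W a x)" for x
  have w: "W a = (\<lambda>x. ennreal (w x))" using W_finite by (auto simp: w_def fun_eq_iff)
  have "(\<integral>\<^sup>+ x. ennreal (w x powr \<gamma>) \<partial>lborel) < \<infinity>"
    using W_Lp[of a] unfolding w by (simp add: w_def)
  then have "\<forall>\<^sub>F \<tau> in at_right 0. Lp_close \<gamma> (sg \<tau> (W a)) (W a) (ennreal \<delta>)"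
    unfolding w by (intro sg_tendsto_Lp \<gamma> \<delta>) (simp_all add: w_def)
  then obtain \<rho> where \<rho>: "0 < \<rho>" "\<And>\<tau>. 0 < \<tau> \<Longrightarrow> \<tau> < \<rho> \<Longrightarrow> Lp_close \<gamma> (sg \<tau> (W a)) (W a) (ennreal \<delta>)"
    unfolding eventually_at_right_field by auto
  show ?thesis
  \<comment> \<open>At \<open>t = 0\<close> there is no earlier time: \<open>a = t\<close>, the
    limit is one-sided, and the third comparison is trivial.\<close>
  proof (cases "t = 0")
    case True
    then have a0: "a = 0" using r by (simp add: a_def)
    have "Lp_close \<gamma> (W s) (W t) (ennreal \<epsilon>)" if s: "0 \<le> s" "s \<noteq> t" "dist s t < min r \<rho>" for s
    proof -
      have s': "0 < s" "s < r" "s < \<rho>" using s True by auto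
      have "Lp_close \<gamma> (W s) (sg s (W 0)) (ennreal \<delta>)" using flow[of s] s' True a0 by simp
      moreover have "Lp_close \<gamma> (sg s (W 0)) (W 0) (ennreal \<delta>)" using \<rho>(2)[of s] s' a0 by simp
      ultimately show ?thesis using trans3[OF _ _ Lp_close_refl] True by blast
    qed
    then show ?thesis using r \<rho> unfolding eventually_at by (intro exI[of _ "min r \<rho>"]) auto
  next
    case False
    then have at: "a < t" using t r by (auto simp: a_def)
    have "Lp_close \<gamma> (W s) (W t) (ennreal \<epsilon>)" if s: "s \<noteq> t" "dist s t < min (t - a) (min r \<rho>)" for s
    proof -
      have s': "a < s" "s \<le> t + r" "\<bar>s - t\<bar> < \<rho>" using s by (auto simp: dist_real_def)
      \<comment> \<open>The longer evolution is the shorter one applied to a brief evolution of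
        \<open>W a\<close>, so contractivity reduces the comparison to times near 0.\<close>
      have "Lp_close \<gamma> (sg (s - a) (W a)) (sg (t - a) (W a)) (ennreal \<delta>)"
      proof (cases "t < s")
        case True
        have "Lp_close \<gamma> (sg (t - a) (sg (s - t) (W a))) (sg (t - a) (W a)) (ennreal \<delta>)"
          by (rule Lp_close_sg) (use \<rho>(2)[of "s - t"] True s' at \<gamma> in auto)
        moreover have "sg (t - a) (sg (s - t) (W a)) = sg (s - a) (W a)"
          using True at by (simp add: fun_eq_iff sg_sg)
        ultimately show ?thesis by simp
      next
        case F: False
        have "Lp_close \<gamma> (sg (s - a) (sg (t - s) (W a))) (sg (s - a) (W a)) (ennreal \<delta>)"
          by (rule Lp_close_sg) (use \<rho>(2)[of "t - s"] F s s' at \<gamma> in auto)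
        moreover have "sg (s - a) (sg (t - s) (W a)) = sg (t - a) (W a)"
          using F s(1) s' by (simp add: fun_eq_iff sg_sg)
        ultimately show ?thesis by (simp add: Lp_close_sym)
      qed
      from trans3[OF flow this Lp_close_sym[OF flow]] show ?thesis using s' at r by simp
    qed
    then show ?thesis using r \<rho> at unfolding eventually_at
      by (intro exI[of _ "min (t - a) (min r \<rho>)"]) auto
  qed
qed

lemma mild_solution:
  defines "u \<equiv> \<lambda>t x. enn2real (W t x)"
  shows "(\<lambda>(t, x). u t x) \<in> borel_measurable (borel \<Otimes>\<^sub>M borel)"
    and "(\<integral>\<^sup>+ x. ennreal (\<bar>u t x\<bar> powr \<gamma>) \<partial>lborel) < \<infinity>"
    and "0 \<le> t \<Longrightarrow> ((\<lambda>s. \<integral>\<^sup>+ x. ennreal (\<bar>u s x - u t x\<bar> powr \<gamma>) \<partial>lborel) \<longlongrightarrow> 0) (at t within {0..})"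
    and "u 0 x = u0 x"
    and "0 < t \<Longrightarrow> ennreal (u t x) = v t x +
      (\<integral>\<^sup>+ \<tau>\<in>{0..t}. (\<integral>\<^sup>+ y. P (t - \<tau>) x y * ennreal (f (u \<tau> y)) \<partial>lborel) \<partial>lborel)"
    and "\<exists>C>1. \<forall>t>0. \<forall>x. v t x \<le> ennreal (u t x) \<and> ennreal (u t x) \<le> ennreal C * v t x"
proof -
  have uW: "ennreal (u t x) = W t x" for t x using W_finite by (simp add: u_def)
  have "(\<lambda>z. if fst z = 0 then u0 (snd z) else enn2real (U (fst z) (snd z))) \<in> borel_measurable (borel \<Otimes>\<^sub>M borel)"
    by measurable
  also have "(\<lambda>z. if fst z = 0 then u0 (snd z) else enn2real (U (fst z) (snd z))) = (\<lambda>(t, x). u t x)"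
    by (auto simp: u_def W_def u0_nonneg fun_eq_iff)
  finally show "(\<lambda>(t, x). u t x) \<in> borel_measurable (borel \<Otimes>\<^sub>M borel)" .
  have "(\<integral>\<^sup>+ x. ennreal (\<bar>u t x\<bar> powr \<gamma>) \<partial>lborel) = (\<integral>\<^sup>+ x. ennpow (W t x) \<gamma> \<partial>lborel)"
    unfolding uW[symmetric] by (simp add: u_def)
  then show "(\<integral>\<^sup>+ x. ennreal (\<bar>u t x\<bar> powr \<gamma>) \<partial>lborel) < \<infinity>" using W_Lp by simp
  show "((\<lambda>s. \<integral>\<^sup>+ x. ennreal (\<bar>u s x - u t x\<bar> powr \<gamma>) \<partial>lborel) \<longlongrightarrow> 0) (at t within {0..})" if t: "0 \<le> t"
  proof (rule tendsto_zero_ennreal)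
    fix r :: real assume r: "0 < r"
    have "\<forall>\<^sub>F s in at t within {0..}. Lp_close \<gamma> (W s) (W t) (ennreal (r / 2))"
      using W_continuous[OF t] r by simp
    then show "\<forall>\<^sub>F s in at t within {0..}. (\<integral>\<^sup>+ x. ennreal (\<bar>u s x - u t x\<bar> powr \<gamma>) \<partial>lborel) < ennreal r"
    proof eventually_elim
      case (elim s)
      have "Lp_close \<gamma> (\<lambda>x. ennreal (u s x)) (\<lambda>x. ennreal (u t x)) (ennreal (r / 2))"
        using elim by (simp add: uW)
      then have "(\<integral>\<^sup>+ x. ennreal (\<bar>u s x - u t x\<bar> powr \<gamma>) \<partial>lborel) \<le> ennreal (r / 2)"
        by (rule Lp_close_realD) (use \<gamma> in \<open>auto simp: u_def\<close>)
      also have "\<dots> < ennreal r" using r by (intro ennreal_lessI) auto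
      finally show ?case .
    qed
  qed
  show "u 0 x = u0 x" by (simp add: u_def W_0 u0_nonneg)
  show "ennreal (u t x) = v t x +
      (\<integral>\<^sup>+ \<tau>\<in>{0..t}. (\<integral>\<^sup>+ y. P (t - \<tau>) x y * ennreal (f (u \<tau> y)) \<partial>lborel) \<partial>lborel)" if "0 < t"
  proof -
    have "duhamel 0 t U x = (\<integral>\<^sup>+ \<tau>\<in>{0..t}. (\<integral>\<^sup>+ y. P (t - \<tau>) x y * ennreal (f (u \<tau> y)) \<partial>lborel) \<partial>lborel)"
      unfolding duhamel_def
    proof (rule nn_integral_cong_AE)
      \<comment> \<open>At time 0 the function \<open>U\<close> is zero while \<open>u\<close>
        equals the initial datum; a single time does not affect the integral.\<close>
      show "AE \<tau> in lborel. sg (t - \<tau>) (\<lambda>y. F (U \<tau> y)) x * indicator {0..t} \<tau> =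
         (\<integral>\<^sup>+ y. P (t - \<tau>) x y * ennreal (f (u \<tau> y)) \<partial>lborel) * indicator {0..t} \<tau>"
        using AE_lborel_singleton[of 0]
        by eventually_elim (simp add: sg_def F_def u_def W_U)
    qed
    then show ?thesis using U_eq[of t x] that by (simp add: uW W_U)
  qed
  obtain C where C: "1 < (C::real)" "\<And>t x. U t x \<le> ennreal C * v t x"
    by (rule U_bounds) (rule that)
  have "v t x \<le> U t x" for t x by (subst U_eq) simp
  then show "\<exists>C>1. \<forall>t>0. \<forall>x. v t x \<le> ennreal (u t x) \<and> ennreal (u t x) \<le> ennreal C * v t x"
    using C by (intro exI[of _ C]) (auto simp: uW W_U)
qed

end

section \<open>Carnot--Caratheodory geometry and concentration of the heat kernel\<close>

text \<open>Moves from the completion to a Borel null set, to which outer regularity and affine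
  substitution in \<open>lborel\<close> apply.\<close>

lemma AE_lebesgue_null_superset:
  assumes "AE x in lebesgue. P x"
  obtains N where "N \<in> null_sets lborel" "{x. \<not> P x} \<subseteq> N"
proof -
  obtain N0 where "N0 \<in> null_sets lebesgue" "{x. \<not> P x} \<subseteq> N0"
    using assms by (auto simp: eventually_ae_filter)
  then show ?thesis using that unfolding null_sets_completion_iff2 by blast
qed

text \<open>A mean value inequality with an exceptional null set. Cover that set by an open
  \<open>G\<close> of measure below \<open>\<epsilon>\<close>: at good points the derivative gives
  slope at most \<open>M + \<epsilon>\<close>, and near the others the Lipschitz constant is charged
  to the measure of \<open>G\<close>. Bisection glues the local estimates, and
  \<open>\<epsilon>\<close> tends to 0.\<close>

lemma lipschitz_AE_derivative_bound:
  fixes g :: "real \<Rightarrow> 'a::real_normed_vector"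
  assumes lip: "L-lipschitz_on {0..T} g" and T: "0 \<le> T"
    and der: "AE t in lebesgue. t \<in> {0..T} \<longrightarrow>
      (\<exists>v. norm v \<le> M \<and> (g has_vector_derivative v) (at t within {0..T}))"
  shows "norm (g T - g 0) \<le> M * T"
proof -
  define good where "good t \<longleftrightarrow> t \<in> {0..T} \<longrightarrow>
      (\<exists>v. norm v \<le> M \<and> (g has_vector_derivative v) (at t within {0..T}))" for t
  obtain N where N: "N \<in> null_sets lborel" "{t. \<not> good t} \<subseteq> N"
    using AE_lebesgue_null_superset[OF der] by (auto simp: good_def)
  have L: "L \<ge> 0" using lipschitz_on_nonneg[OF lip] .
  have *: "norm (g T - g 0) \<le> (M + \<epsilon>) * T + L * \<epsilon>" if eps: "\<epsilon> > 0" for \<epsilon>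
  proof -
    obtain G where G: "N \<subseteq> G" "open G" "emeasure lborel (G - N) < ennreal \<epsilon>"
      using outer_regular_lborel[of N \<epsilon>] N eps by (metis null_setsD2 sets_lborel)
    have [measurable]: "G \<in> sets borel" "N \<in> sets borel" using G N by auto
    have "emeasure lborel G = emeasure lborel (G - N)"
      using N by (simp add: emeasure_Diff_null_set)
    then have mG: "emeasure lborel G < ennreal \<epsilon>" using G by simp
    have fin: "emeasure lborel (G \<inter> S) \<noteq> \<infinity>" for S
      using le_less_trans[OF emeasure_mono[of "G \<inter> S" G lborel] less_trans[OF mG ennreal_less_top]] by auto
    define m where "m a b = measure lborel (G \<inter> {a<..b})" for a b
    have madd: "m a c = m a b + m b c" if "a \<le> b" "b \<le> c" for a b c
    proof -
      have "G \<inter> {a<..c} = (G \<inter> {a<..b}) \<union> (G \<inter> {b<..c})" using that by auto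
      then show ?thesis unfolding m_def
        using fin by (subst measure_Union[symmetric]) (auto simp: disjoint_iff)
    qed
    have m0: "m a b \<ge> 0" for a b by (simp add: m_def)
    \<comment> \<open>Both terms on the right are additive over adjacent intervals, which lets
      \<open>Bolzano\<close> glue; the implications confine the claim to subintervals of
      \<open>{0..T}\<close>.\<close>
    define P where "P a b \<longleftrightarrow> (0 \<le> a \<longrightarrow> b \<le> T \<longrightarrow> norm (g b - g a) \<le> (M + \<epsilon>) * (b - a) + L * m a b)" for a b
    have "P 0 T"
    proof (rule Bolzano[OF T])
      fix a b c assume P: "P a b" "P b c" and abc: "a \<le> b" "b \<le> c"
      show "P a c" unfolding P_def
      proof (intro impI)
        assume ac: "0 \<le> a" "c \<le> T"
        have "norm (g c - g a) \<le> norm (g c - g b) + norm (g b - g a)"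
          by (metis diff_add_cancel add_diff_eq norm_triangle_ineq)
        then show "norm (g c - g a) \<le> (M + \<epsilon>) * (c - a) + L * m a c"
          using P abc ac unfolding P_def madd[OF abc] by (simp add: algebra_simps)
      qed
    next
      fix x assume x: "0 \<le> x" "x \<le> T"
      show "\<exists>d>0. \<forall>a b. a \<le> x \<and> x \<le> b \<and> b - a < d \<longrightarrow> P a b"
      proof (cases "good x")
        case True
        then obtain v where v: "norm v \<le> M" "(g has_vector_derivative v) (at x within {0..T})"
          using x by (auto simp: good_def)
        then obtain d where d: "d > 0" "\<And>y. y \<in> {0..T} \<Longrightarrow> norm (y - x) < d \<Longrightarrow>
            norm (g y - g x - (y - x) *\<^sub>R v) \<le> \<epsilon> * norm (y - x)"
          using eps unfolding has_vector_derivative_def has_derivative_within_alt by meson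
        have step: "norm (g y - g x) \<le> (M + \<epsilon>) * \<bar>y - x\<bar>" if y: "y \<in> {0..T}" "\<bar>y - x\<bar> < d" for y
        proof -
          have "norm (g y - g x) \<le> norm (g y - g x - (y - x) *\<^sub>R v) + norm ((y - x) *\<^sub>R v)"
            by (metis diff_add_cancel norm_triangle_ineq)
          also have "\<dots> \<le> \<epsilon> * \<bar>y - x\<bar> + \<bar>y - x\<bar> * M"
            using d(2)[of y] y v by (intro add_mono) (auto intro!: mult_left_mono)
          finally show ?thesis by (simp add: algebra_simps)
        qed
        show ?thesis
        proof (intro exI[of _ d] conjI allI impI d)
          fix a b assume ab: "a \<le> x \<and> x \<le> b \<and> b - a < d"
          show "P a b" unfolding P_def
          proof (intro impI)
            assume "0 \<le> a" "b \<le> T"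
            then have 1: "norm (g b - g x) \<le> (M + \<epsilon>) * \<bar>b - x\<bar>" "norm (g a - g x) \<le> (M + \<epsilon>) * \<bar>a - x\<bar>"
              using step[of a] step[of b] ab by auto
            have "norm (g b - g a) \<le> norm (g b - g x) + norm (g a - g x)"
              by (metis diff_diff_eq2 diff_add_cancel norm_triangle_ineq4)
            also have "\<dots> \<le> (M + \<epsilon>) * (b - a)"
              using 1 ab by (simp add: algebra_simps)
            finally show "norm (g b - g a) \<le> (M + \<epsilon>) * (b - a) + L * m a b"
              using m0[of a b] L by (smt (verit) mult_nonneg_nonneg)
          qed
        qed
      next
        case False
        then have "x \<in> G" using N G by auto
        then obtain d where d: "d > 0" "ball x d \<subseteq> G" using G by (auto simp: open_contains_ball)
        show ?thesis
        proof (intro exI[of _ d] conjI allI impI d)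
          fix a b assume ab: "a \<le> x \<and> x \<le> b \<and> b - a < d"
          then have "G \<inter> {a<..b} = {a<..b}" using d by (auto simp: dist_real_def subset_iff)
          then have m: "m a b = b - a" using ab by (simp add: m_def)
          show "P a b" unfolding P_def
          proof (intro impI)
            assume T': "0 \<le> a" "b \<le> T"
            have 1: "norm (g b - g a) \<le> L * (b - a)"
              using lipschitz_onD[OF lip, of b a] T' ab by (simp add: dist_norm)
            \<comment> \<open>A negative \<open>M\<close> admits no good point, so a nondegenerate
              interval would lie in the null set \<open>N\<close>.\<close>
            have "M \<ge> 0 \<or> a = b"
            proof (rule ccontr)
              assume "\<not> (M \<ge> 0 \<or> a = b)"
              then have "a < b" "M < 0" using ab by auto
              then have "{a..b} \<subseteq> {t. \<not> good t}"
                using T' norm_ge_zero by (auto simp: good_def dest: order_trans[OF norm_ge_zero])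
              then have "{a..b} \<subseteq> N" using N by auto
              then have "emeasure lborel {a..b} \<le> emeasure lborel N"
                by (intro emeasure_mono) auto
              then show False using N \<open>a < b\<close> by (auto simp: null_setsD1)
            qed
            then have "0 \<le> (M + \<epsilon>) * (b - a)" using ab eps by auto
            then show "norm (g b - g a) \<le> (M + \<epsilon>) * (b - a) + L * m a b"
              using 1 unfolding m by linarith
          qed
        qed
      qed
    qed
    then have "norm (g T - g 0) \<le> (M + \<epsilon>) * T + L * m 0 T" using T by (simp add: P_def)
    also have "m 0 T \<le> \<epsilon>"
    proof -
      have "ennreal (m 0 T) = emeasure lborel (G \<inter> {0<..T})"
        unfolding m_def using fin by (simp add: emeasure_eq_ennreal_measure)
      also have "\<dots> \<le> emeasure lborel G" by (intro emeasure_mono) auto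
      also have "\<dots> \<le> ennreal \<epsilon>" using mG by simp
      finally show ?thesis using eps by simp
    qed
    then have "L * m 0 T \<le> L * \<epsilon>" using L by (rule mult_left_mono)
    finally show ?thesis by simp
  qed
  have "((\<lambda>\<epsilon>. (M + \<epsilon>) * T + L * \<epsilon>) \<longlongrightarrow> (M + 0) * T + L * 0) (at_right 0)"
    by (intro tendsto_intros)
  moreover have "\<forall>\<^sub>F \<epsilon> in at_right 0. norm (g T - g 0) \<le> (M + \<epsilon>) * T + L * \<epsilon>"
    unfolding eventually_at_right_field using * by (intro exI[of _ 1]) auto
  ultimately have "norm (g T - g 0) \<le> (M + 0) * T + L * 0"
    by (rule tendsto_lowerbound) simp
  then show ?thesis by simp
qed

text \<open>The coefficients of a subunit curve are at most 1 in absolute value, so its speed in the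
  closed ball of radius \<open>e\<close> is at most some \<open>M\<close>; reaching the sphere takes
  at least the time \<open>e / M\<close>.\<close>

lemma subunit_exit_time:
  fixes X :: "nat \<Rightarrow> real^'n \<Rightarrow> real^'n"
  assumes cont: "\<And>j. j < m \<Longrightarrow> continuous_on UNIV (X j)" and e: "0 < e"
  obtains r where "r > 0"
    "\<And>T \<gamma>. \<lbrakk>0 \<le> T; subunit X m T \<gamma>; \<gamma> 0 = x; e \<le> dist x (\<gamma> T)\<rbrakk> \<Longrightarrow> r \<le> T"
proof -
  have "continuous_on (cball x e) (\<lambda>y. \<Sum>j<m. norm (X j y))"
    by (intro continuous_intros continuous_on_subset[OF cont]) auto
  then have "compact ((\<lambda>y. \<Sum>j<m. norm (X j y)) ` cball x e)"
    by (intro compact_continuous_image) auto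
  then have "bounded ((\<lambda>y. \<Sum>j<m. norm (X j y)) ` cball x e)" by (rule compact_imp_bounded)
  then obtain M where M: "M > 0" "\<And>y. dist x y \<le> e \<Longrightarrow> (\<Sum>j<m. norm (X j y)) \<le> M"
    unfolding bounded_pos by (force simp: sum_nonneg)
  show ?thesis
  proof (rule that[of "e / M"])
    show "e / M > 0" using e M by simp
    fix T and \<gamma> :: "real \<Rightarrow> real^'n"
    assume T: "0 \<le> T" and su: "subunit X m T \<gamma>" and 0: "\<gamma> 0 = x" and far: "e \<le> dist x (\<gamma> T)"
    obtain L where L: "L-lipschitz_on {0..T} \<gamma>" using su by (auto simp: subunit_def)
    then have cg: "continuous_on {0..T} \<gamma>" by (rule lipschitz_on_continuous_on)
    have cd: "continuous_on {0..T} (\<lambda>t. dist x (\<gamma> t))" by (intro continuous_intros cg)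
    \<comment> \<open>The times at distance exactly \<open>e\<close>; the least of them is the first
      hitting time, up to which the curve stays in the ball.\<close>
    define Z where "Z = {t \<in> {0..T}. dist x (\<gamma> t) = e}"
    have "closed Z" unfolding Z_def
      using continuous_closed_preimage_constant[OF cd, of e] by simp
    then have "compact Z" by (intro compact_eq_bounded_closed[THEN iffD2] conjI)
        (auto simp: Z_def intro: bounded_subset[OF bounded_closed_interval[of 0 T]])
    moreover have "Z \<noteq> {}"
      using IVT'[of "\<lambda>t. dist x (\<gamma> t)" 0 e T, OF _ far T cd] 0 e by (auto simp: Z_def)
    ultimately obtain t where t: "t \<in> Z" "\<And>s. s \<in> Z \<Longrightarrow> t \<le> s" using compact_attains_inf by metis
    have cs: "continuous_on {0..s} (\<lambda>u. dist x (\<gamma> u))" if "s \<le> T" for s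
      by (rule continuous_on_subset[OF cd]) (use that in auto)
    have inside: "dist x (\<gamma> s) \<le> e" if s: "s \<in> {0..t}" for s
    proof (rule ccontr)
      assume n: "\<not> ?thesis"
      have "\<exists>s'\<ge>0. s' \<le> s \<and> dist x (\<gamma> s') = e"
        by (rule IVT') (use n s t 0 e cs[of s] in \<open>auto simp: Z_def\<close>)
      then obtain s' where s': "0 \<le> s'" "s' \<le> s" "dist x (\<gamma> s') = e" by auto
      then have "s' \<in> Z" using s t by (auto simp: Z_def)
      then have "s = t" using t(2)[of s'] s' s by auto
      then show False using n t by (auto simp: Z_def)
    qed
    have "norm (\<gamma> t - \<gamma> 0) \<le> M * t"
    proof (rule lipschitz_AE_derivative_bound)
      show "L-lipschitz_on {0..t} \<gamma>"
        by (rule lipschitz_on_subset[OF L]) (use t in \<open>auto simp: Z_def\<close>)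
      show "0 \<le> t" using t by (auto simp: Z_def)
      have "AE t in lebesgue. t \<in> {0..T} \<longrightarrow>
        (\<exists>c::nat \<Rightarrow> real. (\<Sum>j<m. (c j)^2) \<le> 1 \<and>
            (\<gamma> has_vector_derivative (\<Sum>j<m. c j *\<^sub>R X j (\<gamma> t))) (at t within {0..T}))"
        using su by (auto simp: subunit_def)
      then show "AE s in lebesgue. s \<in> {0..t} \<longrightarrow>
          (\<exists>v. norm v \<le> M \<and> (\<gamma> has_vector_derivative v) (at s within {0..t}))"
      proof (rule AE_mp, intro AE_I2 impI)
        fix s assume *: "s \<in> {0..T} \<longrightarrow> (\<exists>c::nat \<Rightarrow> real. (\<Sum>j<m. (c j)^2) \<le> 1 \<and>
            (\<gamma> has_vector_derivative (\<Sum>j<m. c j *\<^sub>R X j (\<gamma> s))) (at s within {0..T}))"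
          and s: "s \<in> {0..t}"
        have sT: "s \<in> {0..T}" using s t by (auto simp: Z_def)
        then obtain c :: "nat \<Rightarrow> real" where c: "(\<Sum>j<m. (c j)^2) \<le> 1"
           "(\<gamma> has_vector_derivative (\<Sum>j<m. c j *\<^sub>R X j (\<gamma> s))) (at s within {0..T})"
          using * by auto
        have cj: "\<bar>c j\<bar> \<le> 1" if "j < m" for j
        proof -
          have "(c j)^2 \<le> (\<Sum>j<m. (c j)^2)" by (rule member_le_sum) (use that in auto)
          then show ?thesis using c(1) abs_square_le_1[of "c j"] by linarith
        qed
        have "norm (\<Sum>j<m. c j *\<^sub>R X j (\<gamma> s)) \<le> (\<Sum>j<m. norm (X j (\<gamma> s)))"
        proof (rule sum_norm_le)
          fix j assume "j \<in> {..<m}"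
          then show "norm (c j *\<^sub>R X j (\<gamma> s)) \<le> norm (X j (\<gamma> s))"
            using mult_right_mono[OF cj norm_ge_zero, of j "X j (\<gamma> s)"] by simp
        qed
        also have "\<dots> \<le> M" using M(2) inside[OF s] by simp
        finally show "\<exists>v. norm v \<le> M \<and> (\<gamma> has_vector_derivative v) (at s within {0..t})"
          using has_vector_derivative_within_subset[OF c(2), of "{0..t}"] t by (auto simp: Z_def)
      qed
    qed
    moreover have "norm (\<gamma> t - \<gamma> 0) = e" using t 0 by (simp add: Z_def dist_norm norm_minus_commute)
    ultimately have "e \<le> M * t" by simp
    also have "\<dots> \<le> M * T" using t M by (auto simp: Z_def)
    finally show "e / M \<le> T" using M by (simp add: divide_le_eq mult.commute)
  qed
qed

text \<open>The second curve is traversed backwards, which keeps it subunit because the coefficients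
  may change sign.\<close>

lemma subunit_join:
  fixes X :: "nat \<Rightarrow> real^'n \<Rightarrow> real^'n"
  assumes 1: "subunit X m T1 g1" and 2: "subunit X m T2 g2"
    and meet: "g1 T1 = g2 T2" and T: "0 \<le> T1" "0 \<le> T2"
  shows "subunit X m (T1 + T2) (\<lambda>t. if t \<le> T1 then g1 t else g2 (T1 + T2 - t))" (is "subunit X m ?T ?g")
proof -
  define good where "good g T t \<longleftrightarrow> (t \<in> {0..T} \<longrightarrow> (\<exists>c::nat \<Rightarrow> real. (\<Sum>j<m. (c j)^2) \<le> 1 \<and>
       (g has_vector_derivative (\<Sum>j<m. c j *\<^sub>R X j (g t))) (at t within {0..T})))" for g and T t :: real
  obtain L1 L2 where L1: "L1-lipschitz_on {0..T1} g1" and L2: "L2-lipschitz_on {0..T2} g2"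
    using 1 2 by (auto simp: subunit_def)
  have "L2-lipschitz_on {T1..?T} (\<lambda>t. g2 (?T - t))"
  proof (rule lipschitz_onI)
    fix x y assume "x \<in> {T1..?T}" "y \<in> {T1..?T}"
    then show "dist (g2 (?T - x)) (g2 (?T - y)) \<le> L2 * dist x y"
      using lipschitz_onD[OF L2, of "?T - x" "?T - y"] by (simp add: dist_real_def abs_minus_commute)
  qed (rule lipschitz_on_nonneg[OF L2])
  then have lip: "\<exists>L. L-lipschitz_on {0..?T} ?g"
    using lipschitz_on_concat_max[OF L1, of L2 ?T "\<lambda>t. g2 (?T - t)"] meet by auto
  have AE1: "AE t in lebesgue. good g1 T1 t" and AE2: "AE t in lebesgue. good g2 T2 t"
    using 1 2 by (auto simp: subunit_def good_def)
  have "AE t in lebesgue. good g2 T2 (?T - t)"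
  proof -
    obtain N where N: "N \<in> null_sets lborel" "{t. \<not> good g2 T2 t} \<subseteq> N"
      using AE_lebesgue_null_superset[OF AE2] by auto
    have [measurable]: "N \<in> sets borel" using N by auto
    have "AE x in lborel. x \<notin> N" using N by (rule_tac AE_not_in) auto
    then have "AE x in lborel. ?T + (-1) * x \<notin> N"
      by (intro AE_borel_affine[where P="\<lambda>x. x \<notin> N"]) auto
    then have "AE x in lebesgue. ?T + (-1) * x \<notin> N" by (rule AE_completion)
    then show ?thesis by (rule AE_mp) (use N in auto)
  qed
  \<comment> \<open>At the junction the one-sided derivatives may differ, but it is a single
    point.\<close>
  moreover have "AE t in lebesgue. t \<noteq> T1"
    using AE_completion[OF AE_lborel_singleton[of T1]] .
  ultimately have "AE t in lebesgue. good ?g ?T t"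
    using AE1
  proof eventually_elim
    case (elim t)
    show "good ?g ?T t" unfolding good_def
    proof
      assume t: "t \<in> {0..?T}"
      show "\<exists>c::nat \<Rightarrow> real. (\<Sum>j<m. (c j)^2) \<le> 1 \<and>
          (?g has_vector_derivative (\<Sum>j<m. c j *\<^sub>R X j (?g t))) (at t within {0..?T})"
      proof (cases "t < T1")
        case True
        then obtain c :: "nat \<Rightarrow> real" where c: "(\<Sum>j<m. (c j)^2) \<le> 1"
          "(g1 has_vector_derivative (\<Sum>j<m. c j *\<^sub>R X j (g1 t))) (at t within {0..T1})"
          using elim t by (auto simp: good_def)
        have "(?g has_vector_derivative (\<Sum>j<m. c j *\<^sub>R X j (g1 t))) (at t within {0..T1})"
          by (rule has_vector_derivative_transform[OF _ _ c(2)]) (use True t in auto)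
        moreover have "at t within {0..?T} = at t within {0..T1}"
          by (rule at_within_nhd[of _ "{..<T1}"]) (use True T in auto)
        ultimately show ?thesis using c(1) True by auto
      next
        case False
        then have t': "T1 < t" "?T - t \<in> {0..T2}" using elim t by auto
        then obtain c :: "nat \<Rightarrow> real" where c: "(\<Sum>j<m. (c j)^2) \<le> 1"
          "(g2 has_vector_derivative (\<Sum>j<m. c j *\<^sub>R X j (g2 (?T - t)))) (at (?T - t) within {0..T2})"
          using elim t by (auto simp: good_def)
        have im: "(\<lambda>s. ?T - s) ` {T1..?T} = {0..T2}"
          using T by auto
        have "((g2 \<circ> (\<lambda>s. ?T - s)) has_vector_derivative
            ((-1) *\<^sub>R (\<Sum>j<m. c j *\<^sub>R X j (g2 (?T - t))))) (at t within {T1..?T})"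
          by (rule vector_diff_chain_within)
            (auto simp: im c intro!: derivative_eq_intros)
        then have "(?g has_vector_derivative
            ((-1) *\<^sub>R (\<Sum>j<m. c j *\<^sub>R X j (g2 (?T - t))))) (at t within {T1..?T})"
          by (rule has_vector_derivative_transform[rotated 2]) (use t' t meet in auto)
        moreover have "at t within {0..?T} = at t within {T1..?T}"
          by (rule at_within_nhd[of _ "{T1<..}"]) (use t' T in auto)
        ultimately have "(?g has_vector_derivative
            (\<Sum>j<m. (- c j) *\<^sub>R X j (?g t))) (at t within {0..?T})"
          using t' by (simp add: sum_negf)
        then show ?thesis using c(1) by (intro exI[of _ "\<lambda>j. - c j"]) auto
      qed
    qed
  qed
  then show ?thesis using lip by (auto simp: subunit_def good_def)
qed


lemma smooth_map_continuous_on: "smooth_map f \<Longrightarrow> continuous_on UNIV f"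
  by (erule smooth_map.cases) (auto intro: differentiable_imp_continuous_on)

text \<open>Exactly the nonemptiness of the set whose infimum is \<open>cc_dist\<close>; failing it,
  that distance is the unspecified real \<open>Inf {}\<close>.\<close>

definition reachable :: "(nat \<Rightarrow> real^'n \<Rightarrow> real^'n) \<Rightarrow> nat \<Rightarrow> real^'n \<Rightarrow> real^'n \<Rightarrow> bool" where
  "reachable X m x y \<longleftrightarrow> (\<exists>T\<ge>0. \<exists>\<gamma>. subunit X m T \<gamma> \<and> \<gamma> 0 = x \<and> \<gamma> T = y)"

lemma reachable_join:
  assumes "reachable X m x z" "reachable X m y z"
  shows "reachable X m x y"
proof -
  obtain T1 g1 T2 g2 where *: "0 \<le> T1" "subunit X m T1 g1" "g1 0 = x" "g1 T1 = z"
    "0 \<le> T2" "subunit X m T2 g2" "g2 0 = y" "g2 T2 = z"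
    using assms unfolding reachable_def by metis
  then have "subunit X m (T1 + T2) (\<lambda>t. if t \<le> T1 then g1 t else g2 (T1 + T2 - t))"
    by (intro subunit_join) auto
  then show ?thesis unfolding reachable_def using *
    by (intro exI[of _ "T1 + T2"] conjI exI[of _ "\<lambda>t. if t \<le> T1 then g1 t else g2 (T1 + T2 - t)"]) auto
qed

text \<open>A replacement for the Chow--Rashevskii theorem: \<^const>\<open>cc_dist\<close> takes one and the same value
  on all unreachable pairs, so if \<open>x\<close> and \<open>y\<close> were not connected, two balls of finite measure
  would cover the space.\<close>
lemma reachable_if_finite_cc_balls:
  fixes X :: "nat \<Rightarrow> real^'n \<Rightarrow> real^'n"
  assumes fin: "\<And>x r. r > 0 \<Longrightarrow> cc_ball X m x r \<in> sets lborel \<and> emeasure lborel (cc_ball X m x r) < \<infinity>"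
  shows "reachable X m x y"
proof (rule ccontr)
  assume n: "\<not> reachable X m x y"
  \<comment> \<open>A positive radius beyond the common default value \<open>Inf {}\<close>,
    whatever that is.\<close>
  define \<kappa> where "\<kappa> = \<bar>Inf {} :: real\<bar> + 1"
  have *: "z \<in> cc_ball X m w \<kappa>" if "\<not> reachable X m w z" for w z
  proof -
    have "{T. 0 \<le> T \<and> (\<exists>\<gamma>. subunit X m T \<gamma> \<and> \<gamma> 0 = w \<and> \<gamma> T = z)} = {}"
      using that by (auto simp: reachable_def)
    then have "cc_dist X m w z = Inf {}" unfolding cc_dist_def by (rule arg_cong)
    then show ?thesis by (simp add: cc_ball_def \<kappa>_def)
  qed
  \<comment> \<open>A \<open>z\<close> reachable from both points would connect them through
    \<open>reachable_join\<close>; so it is unreachable from one of them and lies in that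
    ball.\<close>
  have "z \<in> cc_ball X m x \<kappa> \<union> cc_ball X m y \<kappa>" for z
    using *[of x z] *[of y z] reachable_join[of X m x z y] n by auto
  then have "UNIV = cc_ball X m x \<kappa> \<union> cc_ball X m y \<kappa>" by auto
  moreover have "\<kappa> > 0" by (simp add: \<kappa>_def)
  ultimately have "emeasure lborel (UNIV :: (real^'n) set) \<le>
      emeasure lborel (cc_ball X m x \<kappa>) + emeasure lborel (cc_ball X m y \<kappa>)"
    using emeasure_subadditive[of "cc_ball X m x \<kappa>" lborel "cc_ball X m y \<kappa>"] fin[of \<kappa>] by simp
  also have "\<dots> < \<infinity>" using fin[OF \<open>\<kappa> > 0\<close>] by simp
  finally show False by simp
qed

text \<open>The exit time bounds every admissible \<open>T\<close> from below; reachability lets the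
  infimum inherit this bound instead of taking its default value.\<close>

lemma cc_dist_pos_away:
  fixes X :: "nat \<Rightarrow> real^'n \<Rightarrow> real^'n"
  assumes cont: "\<And>j. j < m \<Longrightarrow> continuous_on UNIV (X j)" and e: "0 < e"
    and reach: "\<And>y. reachable X m x y"
  obtains r where "r > 0" "\<And>y. e \<le> dist x y \<Longrightarrow> r \<le> cc_dist X m x y"
proof -
  show ?thesis
  proof (rule subunit_exit_time[OF cont e])
    fix r assume r: "0 < r"
      "\<And>T \<gamma>. \<lbrakk>0 \<le> T; subunit X m T \<gamma>; \<gamma> 0 = x; e \<le> dist x (\<gamma> T)\<rbrakk> \<Longrightarrow> r \<le> T"
    have "r \<le> cc_dist X m x y" if "e \<le> dist x y" for y unfolding cc_dist_def
    proof (rule cInf_greatest)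
      show "{T. 0 \<le> T \<and> (\<exists>\<gamma>. subunit X m T \<gamma> \<and> \<gamma> 0 = x \<and> \<gamma> T = y)} \<noteq> {}"
        using reach[of y] by (auto simp: reachable_def)
    qed (use r(2) that in blast)
    then show ?thesis using that r(1) by blast
  qed
qed

section \<open>Small-time concentration from the Gaussian bounds\<close>

lemma heat_kernel_propsD:
  assumes "heat_kernel_props X m \<sigma> Gam"
  shows heat_kernel_continuous: "continuous_on ({0<..} \<times> UNIV \<times> UNIV) (\<lambda>(t, x, y). Gam 0 x t y)"
    and heat_kernel_nonneg: "0 \<le> Gam t x s y"
    and heat_kernel_causal: "s \<le> t \<Longrightarrow> Gam t x s y = 0"
    and heat_kernel_sym: "Gam 0 y t x = Gam 0 x t y"
    and heat_kernel_mass: "0 < t \<Longrightarrow> (\<integral>\<^sup>+ y. ennreal (Gam 0 y t x) \<partial>lborel) = 1"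
    and heat_kernel_semigroup: "0 < t \<Longrightarrow> 0 < s \<Longrightarrow> ennreal (Gam 0 y (t + s) x) =
         (\<integral>\<^sup>+ w. ennreal (Gam 0 w t x * Gam 0 y s w) \<partial>lborel)"
  using assms[unfolded heat_kernel_props_def]
  by (elim conjE, simp only: split_paired_All)+

lemma heat_kernel_gaussian:
  assumes "heat_kernel_props X m \<sigma> Gam"
  obtains \<rho> where "\<rho> > 1"
    "\<And>s x y. s > 0 \<Longrightarrow> 1 / (\<rho> * measure lborel (cc_ball X m x (sqrt s))) * exp (- (\<rho> * (cc_dist X m x y)^2 / s)) \<le> Gam 0 x s y"
    "\<And>s x y. s > 0 \<Longrightarrow> Gam 0 x s y \<le> \<rho> / measure lborel (cc_ball X m x (sqrt s)) * exp (- ((cc_dist X m x y)^2 / (\<rho> * s)))"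
  using assms[unfolded heat_kernel_props_def]
  by (elim conjE exE) simp

lemma heat_kernel_volume:
  assumes "heat_kernel_props X m \<sigma> Gam"
  obtains c where "c > 0" "\<And>x r. r > 0 \<Longrightarrow> ennreal (c * r ^ sum \<sigma> UNIV) \<le> emeasure lborel (cc_ball X m x r)"
  using assms[unfolded heat_kernel_props_def]
  by (elim conjE exE) simp

text \<open>Default values carry information here. A nonmeasurable ball would have
  \<open>emeasure\<close> 0, against the volume bound. A ball of infinite volume would have
  \<open>measure\<close> 0, and then division by zero makes the upper Gaussian bound 0, against unit
  mass.\<close>

lemma heat_kernel_cc_ball:
  fixes X :: "nat \<Rightarrow> real^'n \<Rightarrow> real^'n"
  assumes H: "heat_kernel_props X m \<sigma> Gam" and r: "r > 0"
  shows "cc_ball X m x r \<in> sets lborel" "emeasure lborel (cc_ball X m x r) < \<infinity>"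
    "0 < measure lborel (cc_ball X m x r)"
proof -
  obtain c where c: "c > 0" "\<And>x r. r > 0 \<Longrightarrow> ennreal (c * r ^ sum \<sigma> UNIV) \<le> emeasure lborel (cc_ball X m x r)"
    by (rule heat_kernel_volume[OF H]) (rule that)
  have "0 < ennreal (c * r ^ sum \<sigma> UNIV)" using c(1) r by simp
  from less_le_trans[OF this c(2)[OF r]]
  have "emeasure lborel (cc_ball X m x r) \<noteq> 0" by (metis less_irrefl)
  then show "cc_ball X m x r \<in> sets lborel" using emeasure_notin_sets by metis
  have "measure lborel (cc_ball X m x r) \<noteq> 0"
  proof
    assume 0: "measure lborel (cc_ball X m x r) = 0"
    obtain \<rho> where \<rho>: "\<rho> > 1"
    and lo: "\<And>s x y. s > 0 \<Longrightarrow> 1 / (\<rho> * measure lborel (cc_ball X m x (sqrt s))) * exp (- (\<rho> * (cc_dist X m x y)^2 / s)) \<le> Gam 0 x s y"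
    and up: "\<And>s x y. s > 0 \<Longrightarrow> Gam 0 x s y \<le> \<rho> / measure lborel (cc_ball X m x (sqrt s)) * exp (- ((cc_dist X m x y)^2 / (\<rho> * s)))"
    by (rule heat_kernel_gaussian[OF H]) (rule that)
    have "Gam 0 y (r^2) x \<le> 0" for y
    proof -
      have "Gam 0 y (r^2) x = Gam 0 x (r^2) y" by (rule heat_kernel_sym[OF H])
      also have "\<dots> \<le> 0" using up[of "r^2" x y] r 0 by (simp add: real_sqrt_abs)
      finally show ?thesis .
    qed
    then have "(\<integral>\<^sup>+ y. ennreal (Gam 0 y (r^2) x) \<partial>lborel) = 0"
      by (simp add: ennreal_neg)
    moreover have "(\<integral>\<^sup>+ y. ennreal (Gam 0 y (r^2) x) \<partial>lborel) = 1"
      using heat_kernel_mass[OF H] r by simp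
    ultimately show False by simp
  qed
  then show "0 < measure lborel (cc_ball X m x r)" by (simp add: zero_less_measure_iff)
  then have "emeasure lborel (cc_ball X m x r) \<noteq> \<infinity>" by (auto simp: measure_def)
  then show "emeasure lborel (cc_ball X m x r) < \<infinity>" by (simp add: less_top)
qed

text \<open>With \<open>z = k / s\<close> the quotient equals \<open>sqrt s ^ n / k ^ n\<close>
  times \<open>z ^ n / exp z\<close>; the first factor has a finite limit and the second tends to
  0.\<close>

lemma exp_inverse_dominates_power:
  fixes k :: real
  assumes "k > 0"
  shows "((\<lambda>s. exp (- (k / s)) / sqrt s ^ n) \<longlongrightarrow> 0) (at_right 0)"
proof -
  have "filterlim (\<lambda>s. k / s) at_top (at_right 0)" using assms by real_asymp
  from filterlim_compose[OF tendsto_power_div_exp_0[of n] this]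
  have "((\<lambda>s. sqrt s ^ n / k ^ n * ((k / s) ^ n / exp (k / s))) \<longlongrightarrow> sqrt 0 ^ n / k ^ n * 0) (at_right 0)"
    using assms
    by (intro tendsto_mult tendsto_divide tendsto_power tendsto_const tendsto_real_sqrt tendsto_ident_at) auto
  then have "((\<lambda>s. sqrt s ^ n / k ^ n * ((k / s) ^ n / exp (k / s))) \<longlongrightarrow> 0) (at_right 0)" by simp
  moreover have "\<forall>\<^sub>F s in at_right 0. sqrt s ^ n / k ^ n * ((k / s) ^ n / exp (k / s)) = exp (- (k / s)) / sqrt s ^ n"
    unfolding eventually_at_right_field
  proof (intro exI[of _ 1] conjI allI impI)
    fix s :: real assume s: "0 < s" "s < 1"
    have "s ^ n = sqrt s ^ n * sqrt s ^ n"
      using s by (simp flip: power_mult_distrib)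
    then show "sqrt s ^ n / k ^ n * ((k / s) ^ n / exp (k / s)) = exp (- (k / s)) / sqrt s ^ n"
      using s assms by (simp add: power_divide exp_minus field_simps)
  qed simp
  ultimately show ?thesis by (rule Lim_transform_eventually)
qed

text \<open>Half of the Gaussian factor supplies decay in \<open>s\<close>; the other half is absorbed by the lower
  Gaussian bound at time \<open>2\<rho>\<^sup>2s\<close>, whose kernel has mass one.\<close>
lemma heat_kernel_tail:
  fixes X :: "nat \<Rightarrow> real^'n \<Rightarrow> real^'n"
  assumes HX: "hom_hoermander X m \<sigma>" and H: "heat_kernel_props X m \<sigma> Gam" and e: "e > 0"
  shows "((\<lambda>s. \<integral>\<^sup>+ y. ennreal (Gam 0 y s x) * indicator {y. e \<le> dist x y} y \<partial>lborel) \<longlongrightarrow> 0) (at_right 0)"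
proof -
  have cont: "\<And>j. j < m \<Longrightarrow> continuous_on UNIV (X j)"
    using HX unfolding hom_hoermander_def by (auto intro: smooth_map_continuous_on)
  note ball = heat_kernel_cc_ball[OF H]
  have reach: "reachable X m x y" for y
    by (rule reachable_if_finite_cc_balls) (use ball in auto)
  obtain r0 where r0: "r0 > 0" "\<And>y. e \<le> dist x y \<Longrightarrow> r0 \<le> cc_dist X m x y"
    by (rule cc_dist_pos_away[OF cont e reach]) (assumption, rule that)
  obtain \<rho> where \<rho>: "\<rho> > 1"
    and lo: "\<And>s x y. s > 0 \<Longrightarrow> 1 / (\<rho> * measure lborel (cc_ball X m x (sqrt s))) * exp (- (\<rho> * (cc_dist X m x y)^2 / s)) \<le> Gam 0 x s y"
    and up: "\<And>s x y. s > 0 \<Longrightarrow> Gam 0 x s y \<le> \<rho> / measure lborel (cc_ball X m x (sqrt s)) * exp (- ((cc_dist X m x y)^2 / (\<rho> * s)))"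
    by (rule heat_kernel_gaussian[OF H]) (rule that)
  obtain c where c: "c > 0" "\<And>x r. r > 0 \<Longrightarrow> ennreal (c * r ^ sum \<sigma> UNIV) \<le> emeasure lborel (cc_ball X m x r)"
    by (rule heat_kernel_volume[OF H]) (rule that)
  note sym = heat_kernel_sym[OF H] and mass = heat_kernel_mass[OF H]
    and contG = heat_kernel_continuous[OF H]
  have [measurable]: "(\<lambda>y. Gam 0 y t x) \<in> borel_measurable borel" if "t > 0" for t x
  proof -
    have "continuous_on UNIV (\<lambda>y. (\<lambda>(t, x, y). Gam 0 x t y) (t, y, x))"
      by (rule continuous_on_compose2[OF contG]) (auto intro!: continuous_intros simp: that)
    then show ?thesis by (simp add: borel_measurable_continuous_onI)
  qed
  define q where "q = sum \<sigma> UNIV"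
  define B where "B r = measure lborel (cc_ball X m x r)" for r
  have B_lo: "c * r ^ q \<le> B r" if "r > 0" for r
  proof -
    have "ennreal (c * r ^ q) \<le> ennreal (B r)"
      using c(2)[OF that, of x] ball(2)[OF that, of x] unfolding B_def q_def
      by (simp add: emeasure_eq_ennreal_measure)
    then show ?thesis using ball(3)[OF that, of x] by (simp add: B_def)
  qed
  have B_pos: "0 < B r" if "r > 0" for r using ball(3)[OF that] by (simp add: B_def)
  have B_mono: "B r \<le> B 1" if "r \<le> 1" "r > 0" for r
    unfolding B_def using ball that by (intro measure_mono_fmeasurable) (auto simp: cc_ball_def fmeasurable_def)
  \<comment> \<open>For \<open>d \<ge> r0\<close>, half of the exponent
    \<open>d^2 / (\<rho> * s)\<close> is at least \<open>k / s\<close>.\<close>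
  define k where "k = r0^2 / (2 * \<rho>)"
  have k: "k > 0" using r0 \<rho> by (simp add: k_def)
  \<comment> \<open>Each Gaussian bound contributes a factor \<open>\<rho>\<close>;
    \<open>B 1\<close> bounds the ball volume at the later time, and \<open>c\<close> comes from the
    volume bound at time \<open>s\<close>.\<close>
  define C where "C = \<rho>^2 * B 1 / c"
  have bound: "(\<integral>\<^sup>+ y. ennreal (Gam 0 y s x) * indicator {y. e \<le> dist x y} y \<partial>lborel)
      \<le> ennreal (C * (exp (- (k / s)) / sqrt s ^ q))" if s: "0 < s" "s < 1 / (2 * \<rho>^2)" for s
  proof -
    \<comment> \<open>At this time the exponent \<open>\<rho> * d^2 / s'\<close> of the lower bound
      equals the remaining half \<open>d^2 / (2 * \<rho> * s)\<close>. The restriction on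
      \<open>s\<close> gives \<open>s' < 1\<close>, so the ball of radius \<open>sqrt s'\<close>
      lies in the one of radius 1.\<close>
    define s' where "s' = 2 * \<rho>^2 * s"
    have s': "s' > 0" "s' < 1" using s \<rho> by (auto simp: s'_def field_simps)
    have pw: "Gam 0 y s x \<le> C * (exp (- (k / s)) / sqrt s ^ q) * Gam 0 y s' x" if y: "e \<le> dist x y" for y
    proof -
      define d where "d = cc_dist X m x y"
      have d: "r0 \<le> d" using r0 y by (simp add: d_def)
      then have d2: "r0^2 \<le> d^2" using r0 by (simp add: power_mono)
      have "r0^2 / (2 * \<rho> * s) + d^2 / (2 * \<rho> * s) \<le> d^2 / (\<rho> * s)"
        using d2 s \<rho> by (simp add: field_simps)
      moreover have "\<rho> * d^2 / s' = d^2 / (2 * \<rho> * s)"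
        using \<rho> s by (simp add: s'_def power2_eq_square)
      ultimately have "k / s + \<rho> * d^2 / s' \<le> d^2 / (\<rho> * s)" by (simp add: k_def)
      then have "exp (- (d^2 / (\<rho> * s))) \<le> exp (- (k / s)) * exp (- (\<rho> * d^2 / s'))"
        by (simp flip: exp_add)
      moreover have "exp (- (\<rho> * d^2 / s')) \<le> \<rho> * B (sqrt s') * Gam 0 x s' y"
        using lo[OF s'(1), of x y] \<rho> B_pos[of "sqrt s'"] s' by (simp add: d_def B_def field_simps)
      moreover have "\<dots> \<le> \<rho> * B 1 * Gam 0 x s' y"
        using B_mono[of "sqrt s'"] s' \<rho> heat_kernel_nonneg[OF H]
        by (intro mult_right_mono mult_left_mono) auto
      ultimately have 1: "exp (- (d^2 / (\<rho> * s))) \<le> exp (- (k / s)) * (\<rho> * B 1 * Gam 0 x s' y)"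
        by (smt (verit, best) exp_ge_zero mult_left_mono)
      have 2: "\<rho> / B (sqrt s) \<le> \<rho> / (c * sqrt s ^ q)"
        using B_lo[of "sqrt s"] s c \<rho> by (intro divide_left_mono) (auto intro!: mult_pos_pos B_pos)
      have "Gam 0 y s x = Gam 0 x s y" by (rule sym)
      also have "\<dots> \<le> \<rho> / B (sqrt s) * exp (- (d^2 / (\<rho> * s)))"
        using up[OF s(1), of x y] by (simp add: B_def d_def)
      also have "\<dots> \<le> \<rho> / (c * sqrt s ^ q) * (exp (- (k / s)) * (\<rho> * B 1 * Gam 0 x s' y))"
        using 1 2 \<rho> c s by (intro mult_mono) auto
      also have "\<dots> = C * (exp (- (k / s)) / sqrt s ^ q) * Gam 0 y s' x"
        unfolding sym[of y s' x] C_def by (simp add: power2_eq_square)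
      finally show ?thesis .
    qed
    have C: "C * (exp (- (k / s)) / sqrt s ^ q) \<ge> 0"
      using B_pos[of 1] c s by (simp add: C_def)
    have "(\<integral>\<^sup>+ y. ennreal (Gam 0 y s x) * indicator {y. e \<le> dist x y} y \<partial>lborel)
      \<le> (\<integral>\<^sup>+ y. ennreal (C * (exp (- (k / s)) / sqrt s ^ q)) * ennreal (Gam 0 y s' x) \<partial>lborel)"
      using pw C by (intro nn_integral_mono) (auto split: split_indicator simp flip: ennreal_mult' intro!: ennreal_leI)
    also have "\<dots> = ennreal (C * (exp (- (k / s)) / sqrt s ^ q))"
      using s' mass[of s' x] by (subst nn_integral_cmult) auto
    finally show ?thesis .
  qed
  have "((\<lambda>s. ennreal (C * (exp (- (k / s)) / sqrt s ^ q))) \<longlongrightarrow> ennreal (C * 0)) (at_right 0)"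
    by (intro tendsto_ennrealI tendsto_mult tendsto_const exp_inverse_dominates_power k)
  then have lim: "((\<lambda>s. ennreal (C * (exp (- (k / s)) / sqrt s ^ q))) \<longlongrightarrow> 0) (at_right 0)" by simp
  show ?thesis
  proof (rule tendsto_sandwich[OF _ _ tendsto_const lim])
    show "\<forall>\<^sub>F s in at_right 0. (\<integral>\<^sup>+ y. ennreal (Gam 0 y s x) * indicator {y. e \<le> dist x y} y \<partial>lborel)
      \<le> ennreal (C * (exp (- (k / s)) / sqrt s ^ q))"
      unfolding eventually_at_right_field
      by (rule exI[of _ "1 / (2 * \<rho>^2)"]) (use bound \<rho> in auto)
  qed auto
qed

lemma heat_kernel_imp_symmetric_heat_kernel:
  fixes X :: "nat \<Rightarrow> real^'n \<Rightarrow> real^'n"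
  assumes HX: "hom_hoermander X m \<sigma>" and H: "heat_kernel_props X m \<sigma> Gam"
  shows "symmetric_heat_kernel (\<lambda>t x y. ennreal (Gam 0 y t x))"
proof
  \<comment> \<open>Continuity is known for positive times only; causality supplies the extension by
    zero, and symmetry swaps the space arguments into the order wanted.\<close>
  have "(\<lambda>p :: real \<times> (real^'n) \<times> (real^'n). if p \<in> {0<..} \<times> UNIV \<times> UNIV then (case p of (t, x, y) \<Rightarrow> Gam 0 x t y) else 0)
      \<in> borel_measurable borel"
    by (intro borel_measurable_continuous_on_if heat_kernel_continuous[OF H] borel_open open_Times) auto
  also have "(\<lambda>p :: real \<times> (real^'n) \<times> (real^'n). if p \<in> {0<..} \<times> UNIV \<times> UNIV then (case p of (t, x, y) \<Rightarrow> Gam 0 x t y) else 0)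
      = (\<lambda>(t, x, y). Gam 0 y t x)"
    using heat_kernel_causal[OF H] heat_kernel_sym[OF H] by (auto simp: fun_eq_iff not_less)
  finally have "(\<lambda>p. ennreal (case p of (t, x, y) \<Rightarrow> Gam 0 y t x)) \<in> borel_measurable borel"
    by measurable
  then show "(\<lambda>(t, x, y). ennreal (Gam 0 y t x)) \<in> borel_measurable (borel \<Otimes>\<^sub>M borel \<Otimes>\<^sub>M borel)"
    by (simp add: borel_prod split_beta')
  show "ennreal (Gam 0 y t x) = 0" if "t \<le> 0" for t x y
    using heat_kernel_causal[OF H that] by simp
  show "ennreal (Gam 0 y t x) = ennreal (Gam 0 x t y)" for t x y
    by (simp only: heat_kernel_sym[OF H, of y t x])
  show "(\<integral>\<^sup>+ y. ennreal (Gam 0 y t x) \<partial>lborel) = 1" if "0 < t" for t x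
    by (rule heat_kernel_mass[OF H that])
  show "ennreal (Gam 0 y (t + s) x) = (\<integral>\<^sup>+ w. ennreal (Gam 0 w t x) * ennreal (Gam 0 y s w) \<partial>lborel)"
    if "0 < t" "0 < s" for t s x y
    using heat_kernel_semigroup[OF H that] heat_kernel_nonneg[OF H] by (simp add: ennreal_mult)
  show "((\<lambda>t. \<integral>\<^sup>+ y. ennreal (Gam 0 y t x) * indicator {y. e \<le> dist x y} y \<partial>lborel) \<longlongrightarrow> 0) (at_right 0)"
    if "0 < e" for e x
    by (rule heat_kernel_tail[OF HX H that])
qed

theorem theorem3p2:
  fixes X :: "nat \<Rightarrow> real^'n \<Rightarrow> real^'n" and m :: nat and \<sigma> :: "'n \<Rightarrow> nat"
    and Gam :: "real \<Rightarrow> real^'n \<Rightarrow> real \<Rightarrow> real^'n \<Rightarrow> real"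
    and f :: "real \<Rightarrow> real" and A \<alpha> \<gamma> :: real and u0 :: "real^'n \<Rightarrow> real"
  assumes HX: "hom_hoermander X m \<sigma>"
    and HGam: "heat_kernel_props X m \<sigma> Gam"
    and f_cont: "continuous_on {0..} f"
    and f_mono: "mono_on {0..} f"
    and f_nonneg: "\<forall>u\<ge>0. 0 \<le> f u"
    and f_bound: "\<forall>u\<ge>0. f u \<le> A * u powr \<alpha>"
    and A_pos: "A > 0" and alpha: "\<alpha> > 1"
    and gamma: "1 \<le> \<gamma>"
    and u0_meas: "u0 \<in> borel_measurable lborel"
    and u0_Lg: "(\<integral>\<^sup>+ x. ennreal (\<bar>u0 x\<bar> powr \<gamma>) \<partial>lborel) < \<infinity>"
    and u0_nonneg: "AE x in lborel. 0 \<le> u0 x"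
    and small: "(\<integral>\<^sup>+ t\<in>{0<..}. ennpow (Linf_norm (heat_sg Gam u0 t) lborel) (\<alpha> - 1) \<partial>lborel)
                  < ennreal (1 / (A * (\<alpha> - 1)))"
  shows "\<exists>u :: real \<Rightarrow> real^'n \<Rightarrow> real.
           (\<lambda>(t, x). u t x) \<in> borel_measurable (lborel \<Otimes>\<^sub>M lborel) \<and>
           (\<forall>t\<ge>0. \<forall>x. 0 \<le> u t x) \<and>
           (\<forall>t\<ge>0. u t \<in> borel_measurable lborel \<and>
                   (\<integral>\<^sup>+ x. ennreal (\<bar>u t x\<bar> powr \<gamma>) \<partial>lborel) < \<infinity>) \<and>
           (\<forall>t\<ge>0. ((\<lambda>s. \<integral>\<^sup>+ x. ennreal (\<bar>u s x - u t x\<bar> powr \<gamma>) \<partial>lborel) \<longlongrightarrow> 0)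
                      (at t within {0..})) \<and>
           (AE x in lborel. u 0 x = u0 x) \<and>
           (\<forall>t>0. AE x in lborel.
              ennreal (u t x) = heat_sg Gam u0 t x +
                (\<integral>\<^sup>+ \<tau>\<in>{0..t}. (\<integral>\<^sup>+ y. ennreal (Gam 0 y (t - \<tau>) x * f (u \<tau> y)) \<partial>lborel) \<partial>lborel)) \<and>
           (\<exists>C>1. AE p in (lborel \<Otimes>\<^sub>M lborel). 0 < fst p \<longrightarrow>
              heat_sg Gam u0 (fst p) (snd p) \<le> ennreal (u (fst p) (snd p)) \<and>
              ennreal (u (fst p) (snd p)) \<le> ennreal C * heat_sg Gam u0 (fst p) (snd p))"
proof -
  interpret symmetric_heat_kernel "\<lambda>t x y. ennreal (Gam 0 y t x)"
    by (rule heat_kernel_imp_symmetric_heat_kernel[OF HX HGam])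
  note Gam_nonneg = heat_kernel_nonneg[OF HGam]
  \<comment> \<open>An everywhere nonnegative representative of \<open>u0\<close>. Since
    \<open>ennreal\<close> already cuts off negative values, both have the same heat
    evolution.\<close>
  define w where "w x = max 0 (u0 x)" for x
  have w: "ennreal (w x) = ennreal (u0 x)" for x by (simp add: w_def max_def ennreal_neg)
  have sg_w: "sg t (\<lambda>y. ennreal (w y)) = heat_sg Gam u0 t" for t
    by (simp add: fun_eq_iff sg_def heat_sg_def w ennreal_mult' Gam_nonneg)
  note nonneg_AE = u0_nonneg
  interpret semilinear_heat "\<lambda>t x y. ennreal (Gam 0 y t x)" f A \<alpha> \<gamma> w
  proof
    show "w \<in> borel_measurable borel" using u0_meas unfolding w_def by simp
    have "(\<integral>\<^sup>+ x. ennreal (w x powr \<gamma>) \<partial>lborel) \<le> (\<integral>\<^sup>+ x. ennreal (\<bar>u0 x\<bar> powr \<gamma>) \<partial>lborel)"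
      using gamma by (intro nn_integral_mono ennreal_leI powr_mono2) (auto simp: w_def)
    then show "(\<integral>\<^sup>+ x. ennreal (w x powr \<gamma>) \<partial>lborel) < \<infinity>" using u0_Lg by simp
    show "(\<integral>\<^sup>+ t\<in>{0<..}. ennpow (esssup lborel (sg t (\<lambda>y. ennreal (w y)))) (\<alpha> - 1) \<partial>lborel)
        < ennreal (1 / (A * (\<alpha> - 1)))"
      using small unfolding sg_w Linf_norm_def .
  qed (use assms in \<open>auto simp: w_def\<close>)
  note sol = mild_solution[unfolded v_def sg_w]
  define u where "u t x = enn2real (W t x)" for t x
  note sol = sol[folded u_def]
  have meas: "(\<lambda>(t, x). u t x) \<in> borel_measurable (borel \<Otimes>\<^sub>M borel)" by (rule sol(1))
  have [measurable]: "u t \<in> borel_measurable borel" for t unfolding u_def by measurable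
  obtain C where C: "C > 1"
    "\<forall>t>0. \<forall>x. heat_sg Gam u0 t x \<le> ennreal (u t x) \<and> ennreal (u t x) \<le> ennreal C * heat_sg Gam u0 t x"
    using sol(6) by blast
  show ?thesis
  proof (intro exI[of _ u] conjI allI impI)
    have "sets (lborel \<Otimes>\<^sub>M lborel) = sets (borel \<Otimes>\<^sub>M (borel :: (real^'n) measure))"
      by (rule sets_pair_measure_cong) simp_all
    then show "(\<lambda>(t, x). u t x) \<in> borel_measurable (lborel \<Otimes>\<^sub>M lborel)"
      using meas by (simp cong: measurable_cong_sets)
    show "AE x in lborel. u 0 x = u0 x"
      using nonneg_AE by eventually_elim (simp add: sol(4) w_def)
    fix t :: real
    show "u t \<in> borel_measurable lborel" by simp
    show "(\<integral>\<^sup>+ x. ennreal (\<bar>u t x\<bar> powr \<gamma>) \<partial>lborel) < \<infinity>" by (rule sol(2))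
    show "0 \<le> u t x" for x by (simp add: u_def)
    show "((\<lambda>s. \<integral>\<^sup>+ x. ennreal (\<bar>u s x - u t x\<bar> powr \<gamma>) \<partial>lborel) \<longlongrightarrow> 0) (at t within {0..})" if "0 \<le> t"
      by (rule sol(3)[OF that])
    show "AE x in lborel. ennreal (u t x) = heat_sg Gam u0 t x +
        (\<integral>\<^sup>+ \<tau>\<in>{0..t}. (\<integral>\<^sup>+ y. ennreal (Gam 0 y (t - \<tau>) x * f (u \<tau> y)) \<partial>lborel) \<partial>lborel)" if "0 < t"
      using sol(5)[OF that] by (simp add: ennreal_mult' Gam_nonneg)
  next
    show "\<exists>C>1. AE p in (lborel \<Otimes>\<^sub>M lborel). 0 < fst p \<longrightarrow>
        heat_sg Gam u0 (fst p) (snd p) \<le> ennreal (u (fst p) (snd p)) \<and>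
        ennreal (u (fst p) (snd p)) \<le> ennreal C * heat_sg Gam u0 (fst p) (snd p)"
      using C by (intro exI[of _ C]) auto
  qed
qed

end
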